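(* Let $\mathcal{V}$ be a variety of groups defined by a set of laws $V$, and let $A$ and $B$ be two groups such that $\mathcal{V}M(A\times B)\cong \mathcal{V}M(A)\times \mathcal{V}M(B)$, where $\mathcal{V}M(-)$ denotes the Baer invariant with respect to $\mathcal{V}$. Then $$(V^* )^*(A\times B)=(V^* )^*(A)\times (V^* )^*(B).$$ Consequently, $A\times B$ is $\mathcal{V}$-capable if and only if $A$ and $B$ are both $\mathcal{V}$-capable.
   Context: Let $\mathcal{V}$ be a variety of groups defined by a set of laws (words) $V$. Verbal and marginal subgroups: for a group $G$, the verbal subgroup $V(G)$ is the subgroup generated by all values $v(g_1,\dots,g_n)$ with $v\in V$, $g_i\in G$. The marginal subgroup is $$V^*(G)=\{a\in G : v(g_1,\dots,g_i a,\dots,g_n)=v(g_1,\dots,g_n)\ \text{for all } v\in V,\ \text{all } g_1,\dots,g_n\in G,\ \text{all } 1\le i\le n\}.$$ Baer invariant: if $1\to R\to F\to G\to 1$ is a free presentation of $G$, then $$\mathcal{V}M(G)=\frac{R\cap V(F)}{[RV^*F]},$$ where $[RV^*F]$ is the subgroup of $F$ generated by all elements $v(f_1,\dots,f_i r,\dots,f_n)\,v(f_1,\dots,f_n)^{-1}$ with $r\in R$, $f_j\in F$, $v\in V$, $1\le i\le n$. Up to isomorphism this abelian group is independent of the choice of free presentation. $\mathcal{V}$-capability: a group $G$ is $\mathcal{V}$-capable if there is a group $E$ with $G\cong E/V^*(E)$. The subgroup $(V^* )^*(G)$: this is the intersection of all subgroups of $G$ of the form $\psi(V^*(E))$, where $E$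 is a group and $\psi:E\to G$ is a surjective homomorphism with $\ker\psi\subseteq V^*(E)$. In the displayed equality, $(V^* )^*(A)\times (V^* )^*(B)$ is regarded as a subgroup of $A\times B$ in the obvious way.
   Formalization: The isomorphism VM(A×B) ≅ VM(A)×VM(B) is taken to be the canonical map induced by the two projections; with a merely abstract isomorphism the claim fails (abelian variety, A a countably infinite sum of Z/p, B = Z/p). *)

theory Defs
  imports "HOL-Algebra.Generated_Groups" "HOL-Library.Equipollence"
begin

text \<open>A group word over an alphabet is a list of letters \<open>(x, True)\<close>, standing for \<open>x\<close>, and
  \<open>(x, False)\<close>, standing for the inverse of \<open>x\<close>. The laws of a variety are words in variables
  indexed by the natural numbers; they need not be freely reduced.\<close>

type_synonym 'x gword = "('x \<times> bool) list"

definition word_value :: "('g, 'm) monoid_scheme \<Rightarrow> ('x \<Rightarrow> 'g) \<Rightarrow> 'x gword \<Rightarrow> 'g" where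
  "word_value G g w =
     foldr (\<lambda>(x, b) y. (if b then g x else inv\<^bsub>G\<^esub> (g x)) \<otimes>\<^bsub>G\<^esub> y) w \<one>\<^bsub>G\<^esub>"

definition reduced :: "'x gword \<Rightarrow> bool" where
  "reduced w \<longleftrightarrow> successively (\<lambda>p q. \<not> (fst p = fst q \<and> snd p \<noteq> snd q)) w"

definition verbal :: "nat gword set \<Rightarrow> ('g, 'm) monoid_scheme \<Rightarrow> 'g set" where
  "verbal V G = generate G {word_value G g v | g v. v \<in> V \<and> g \<in> UNIV \<rightarrow> carrier G}"

text \<open>A variable \<open>i\<close> that does not occur in \<open>v\<close> gives a trivial condition in \<open>marginal\<close> and the
  trivial generator in \<open>marginal_commutator\<close>, so \<open>i\<close> need not be bounded.\<close>

definition marginal :: "nat gword set \<Rightarrow> ('g, 'm) monoid_scheme \<Rightarrow> 'g set" where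
  "marginal V G = {a \<in> carrier G. \<forall>v\<in>V. \<forall>g \<in> UNIV \<rightarrow> carrier G. \<forall>i.
     word_value G (g(i := g i \<otimes>\<^bsub>G\<^esub> a)) v = word_value G g v}"

definition marginal_commutator ::
    "nat gword set \<Rightarrow> ('g, 'm) monoid_scheme \<Rightarrow> 'g set \<Rightarrow> 'g set" where  \<comment> \<open>\<open>[R V\<^sup>* F]\<close>\<close>
  "marginal_commutator V F R = generate F
     {word_value F (f(i := f i \<otimes>\<^bsub>F\<^esub> r)) v \<otimes>\<^bsub>F\<^esub> inv\<^bsub>F\<^esub> (word_value F f v) | f i r v.
        v \<in> V \<and> f \<in> UNIV \<rightarrow> carrier F \<and> r \<in> R}"

text \<open>Freeness is expressed inside the group (no non-empty reduced word in the basis is trivial),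
  since a universal property would have to quantify over groups of all types.\<close>

definition free_basis :: "('f, 'm) monoid_scheme \<Rightarrow> 'f set \<Rightarrow> bool" where
  "free_basis F X \<longleftrightarrow> X \<subseteq> carrier F \<and> generate F X = carrier F \<and>
     (\<forall>w. reduced w \<and> w \<noteq> [] \<and> fst ` set w \<subseteq> X \<longrightarrow> word_value F (\<lambda>x. x) w \<noteq> \<one>\<^bsub>F\<^esub>)"

definition free_presentation ::
    "('f, 'm) monoid_scheme \<Rightarrow> ('f \<Rightarrow> 'g) \<Rightarrow> ('g, 'n) monoid_scheme \<Rightarrow> bool" where
  "free_presentation F \<pi> G \<longleftrightarrow> group F \<and> (\<exists>X. free_basis F X) \<and> \<pi> \<in> epi F G"

definition baer_invariant ::
    "nat gword set \<Rightarrow> ('f, 'm) monoid_scheme \<Rightarrow> ('f \<Rightarrow> 'g) \<Rightarrow> ('g, 'n) monoid_scheme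
      \<Rightarrow> 'f set monoid" where
  "baer_invariant V F \<pi> G =
     F\<lparr>carrier := kernel F G \<pi> \<inter> verbal V F\<rparr> Mod marginal_commutator V F (kernel F G \<pi>)"

text \<open>Functoriality of the Baer invariant. If \<open>F \<rightarrow> G\<close> and \<open>F' \<rightarrow> G'\<close> are free presentations, a
  homomorphism \<open>p: G \<rightarrow> G'\<close> has lifts \<open>\<alpha>: F \<rightarrow> F'\<close>, and the map of Baer invariants induced by \<open>p\<close>
  sends the coset \<open>[R V\<^sup>* F] x\<close> to \<open>[R' V\<^sup>* F'] \<alpha>(x)\<close>; it does not depend on the lift. Below, this
  coset is written as the product of \<open>[R' V\<^sup>* F']\<close> with the image of \<open>[R V\<^sup>* F] x\<close>.

  The isomorphism between the Baer invariant of \<open>A \<times> B\<close> and the product of those of \<open>A\<close> and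
  \<open>B\<close> is the one induced by the two projections. This canonical map is always onto, so for finite
  Baer invariants an abstract isomorphism already makes it one. In general it does not: for abelian
  groups as the variety, \<open>A\<close> a direct sum of countably many copies of \<open>Z/p\<close> and \<open>B = Z/p\<close>, the
  multipliers are abstractly isomorphic, yet \<open>A \<times> B\<close> is capable and \<open>B\<close> is not.\<close>

definition is_lift ::
    "('f, 'm) monoid_scheme \<Rightarrow> ('f \<Rightarrow> 'g) \<Rightarrow> ('h, 'k) monoid_scheme \<Rightarrow> ('h \<Rightarrow> 'q)
      \<Rightarrow> ('g \<Rightarrow> 'q) \<Rightarrow> ('f \<Rightarrow> 'h) \<Rightarrow> bool" where
  "is_lift F \<pi> F' \<pi>' p \<alpha> \<longleftrightarrow> \<alpha> \<in> hom F F' \<and> (\<forall>x\<in>carrier F. \<pi>' (\<alpha> x) = p (\<pi> x))"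

definition baer_map ::
    "nat gword set \<Rightarrow> ('h, 'k) monoid_scheme \<Rightarrow> ('h \<Rightarrow> 'q) \<Rightarrow> ('q, 'l) monoid_scheme
      \<Rightarrow> ('f \<Rightarrow> 'h) \<Rightarrow> 'f set \<Rightarrow> 'h set" where
  "baer_map V F' \<pi>' G' \<alpha> C = marginal_commutator V F' (kernel F' G' \<pi>') <#>\<^bsub>F'\<^esub> (\<alpha> ` C)"

text \<open>HOL cannot quantify over the groups of all types inside a formula, so the type \<open>'e\<close> of the
  elements of the groups \<open>E\<close> is a parameter of the next two notions. As soon as \<open>'e\<close> is infinite
  and at least as large as \<open>G\<close>, they do not depend on \<open>'e\<close>: if \<open>\<psi>: E \<rightarrow> G\<close> is onto with kernel in
  \<open>V\<^sup>*(E)\<close>, then the subgroup of \<open>E\<close> generated by one preimage of every element of \<open>G\<close> and, for every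
  preimage outside \<open>V\<^sup>*(E)\<close>, the finitely many elements witnessing this, has the same image of its
  marginal subgroup in \<open>G\<close>, and this subgroup can be copied to \<open>'e\<close>.\<close>

definition epimarginal ::
    "'e itself \<Rightarrow> nat gword set \<Rightarrow> ('g, 'm) monoid_scheme \<Rightarrow> 'g set" where  \<comment> \<open>\<open>(V\<^sup>*)\<^sup>*(G)\<close>\<close>
  "epimarginal U V G = \<Inter> {\<psi> ` marginal V E | (E :: 'e monoid) \<psi>.
     group E \<and> \<psi> \<in> epi E G \<and> kernel E G \<psi> \<subseteq> marginal V E}"

definition capable ::
    "'e itself \<Rightarrow> nat gword set \<Rightarrow> ('g, 'm) monoid_scheme \<Rightarrow> bool" where
  "capable U V G \<longleftrightarrow> (\<exists>E :: 'e monoid. group E \<and> G \<cong> E Mod marginal V E)"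

end

theory Submission
  imports Defs
begin

text \<open>Let \<open>N = [R V\<^sup>* F]\<close> for a free presentation \<open>\<pi>: F \<rightarrow> G\<close> with kernel \<open>R\<close>. Call a surjection
  onto \<open>G\<close> with marginal kernel a marginal extension of \<open>G\<close>. Then \<open>F/N\<close> is one, and since \<open>F\<close> is free
  it maps to every other, compatibly with marginal subgroups; so \<open>(V\<^sup>*)\<^sup>*(G)\<close> is the image of
  \<open>V\<^sup>*(F/N)\<close>, and it is trivial iff \<open>G\<close> is capable.

  Extending by the identity on the other factor shows that \<open>(V\<^sup>*)\<^sup>*(A \<times> B)\<close> lies in the product. Conversely,
  let \<open>y \<in> F\<close> lie over \<open>(a, b)\<close> with \<open>a \<in> (V\<^sup>*)\<^sup>*(A)\<close> and \<open>b \<in> (V\<^sup>*)\<^sup>*(B)\<close>. Every element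
  \<open>c = v(\<dots>, f\<^sub>i y, \<dots>) v(\<dots>, f\<^sub>i, \<dots>)\<^sup>-\<^sup>1\<close> represents a class of the Baer invariant of \<open>A \<times> B\<close> which is
  trivial in those of \<open>A\<close> and \<open>B\<close>. By injectivity \<open>c \<in> N\<close>, that is, \<open>y\<close> is marginal modulo \<open>N\<close>.\<close>

section \<open>Word values and free groups\<close>

lemma word_value_Nil [simp]: "word_value G g [] = \<one>\<^bsub>G\<^esub>"
  and word_value_Cons [simp]: "word_value G g ((x, b) # w) =
    (if b then g x else inv\<^bsub>G\<^esub> (g x)) \<otimes>\<^bsub>G\<^esub> word_value G g w"
  by (simp_all add: word_value_def)

lemma word_value_cong:
  assumes "\<And>x. x \<in> fst ` set w \<Longrightarrow> g x = h x"
  shows "word_value G g w = word_value G h w"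
  using assms by (induction w) auto

context group
begin

lemma word_value_closed:
  assumes "\<And>x. x \<in> fst ` set w \<Longrightarrow> g x \<in> carrier G"
  shows "word_value G g w \<in> carrier G"
  using assms by (induction w) auto

lemma word_value_append:
  assumes "\<And>x. x \<in> fst ` set (u @ w) \<Longrightarrow> g x \<in> carrier G"
  shows "word_value G g (u @ w) = word_value G g u \<otimes> word_value G g w"
  using assms
proof (induction u)
  case (Cons p u)
  obtain x b where p: "p = (x, b)" by fastforce
  have "g x \<in> carrier G" "word_value G g u \<in> carrier G" "word_value G g w \<in> carrier G"
    using Cons.prems by (auto simp: p intro!: word_value_closed)
  with Cons show ?case by (auto simp: p m_assoc)
next
  case Nil
  then have "word_value G g w \<in> carrier G" by (intro word_value_closed) simp
  then show ?case by simp
qed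

definition (in -) inv_word :: "'x gword \<Rightarrow> 'x gword" where
  "inv_word w = rev (map (\<lambda>(x, b). (x, \<not> b)) w)"

lemma (in -) inv_word_letters: "fst ` set (inv_word w) = fst ` set w"
  by (force simp: inv_word_def)

lemma word_value_inv_word:
  assumes "\<And>x. x \<in> fst ` set w \<Longrightarrow> g x \<in> carrier G"
  shows "word_value G g (inv_word w) = inv word_value G g w"
  using assms
proof (induction w)
  case (Cons p w)
  obtain x b where p: "p = (x, b)" by fastforce
  have g: "\<And>y. y \<in> fst ` set (inv_word w @ [(x, \<not> b)]) \<Longrightarrow> g y \<in> carrier G"
    using Cons.prems inv_word_letters[of w] by (auto simp: p)
  have "word_value G g (inv_word (p # w)) =
      word_value G g (inv_word w) \<otimes> word_value G g [(x, \<not> b)]"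
    unfolding p using word_value_append[of "inv_word w" "[(x, \<not> b)]" g, OF g]
    by (simp add: inv_word_def del: word_value_Cons)
  moreover have "word_value G g w \<in> carrier G" "g x \<in> carrier G"
    using Cons.prems by (auto simp: p intro!: word_value_closed)
  ultimately show ?case using Cons by (auto simp: p inv_mult_group)
qed (simp add: inv_word_def)

text \<open>Words name the elements of a generated subgroup. This serves to define maps out of a
  free group, to compare homomorphisms on generators and to bound the size of a generated
  subgroup.\<close>

lemma generate_eq_word_value:
  assumes "T \<subseteq> carrier G" "y \<in> generate G T"
  shows "\<exists>w. fst ` set w \<subseteq> T \<and> word_value G (\<lambda>x. x) w = y"
  using assms(2)
proof induction
  case one
  show ?case by (rule exI[of _ "[]"]) simp
next
  case (incl h)
  then show ?case using assms(1) by (intro exI[of _ "[(h, True)]"]) auto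
next
  case (inv h)
  then show ?case using assms(1) by (intro exI[of _ "[(h, False)]"]) auto
next
  case (eng a b)
  then obtain u w where "fst ` set u \<subseteq> T" "word_value G (\<lambda>x. x) u = a"
    "fst ` set w \<subseteq> T" "word_value G (\<lambda>x. x) w = b" by blast
  then show ?case
    using assms(1) by (intro exI[of _ "u @ w"]) (subst word_value_append, auto)
qed

lemma word_value_subgroup:
  assumes "subgroup H G" "\<And>x. x \<in> fst ` set w \<Longrightarrow> g x \<in> H"
  shows "word_value (G\<lparr>carrier := H\<rparr>) g w = word_value G g w"
  using assms(2) by (induction w) (auto simp: m_inv_consistent[OF assms(1)])

lemma word_value_cancel:
  assumes "\<And>y. y \<in> fst ` set (u @ (x, b) # (x, \<not> b) # w) \<Longrightarrow> g y \<in> carrier G"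
  shows "word_value G g (u @ (x, b) # (x, \<not> b) # w) = word_value G g (u @ w)"
proof -
  have [simp]: "g x \<in> carrier G" "word_value G g w \<in> carrier G"
    using assms by (auto intro!: word_value_closed)
  have "word_value G g ((x, b) # (x, \<not> b) # w) = word_value G g w"
    by (simp add: m_assoc[symmetric])
  then show ?thesis
    using assms by (subst (1 2) word_value_append) (auto simp del: word_value_Cons)
qed

end

lemma (in group_hom) word_value_hom:
  assumes "\<And>x. x \<in> fst ` set w \<Longrightarrow> g x \<in> carrier G"
  shows "h (word_value G g w) = word_value H (\<lambda>x. h (g x)) w"
  using assms
proof (induction w)
  case (Cons p w)
  obtain x b where p: "p = (x, b)" by fastforce
  have "word_value G g w \<in> carrier G" "g x \<in> carrier G"
    using Cons.prems by (auto simp: p intro!: G.word_value_closed)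
  with Cons show ?case by (auto simp: p)
qed simp

section \<open>Free reduction and the universal property of a free basis\<close>

lemma not_reducedE:
  assumes "\<not> reduced w"
  obtains u x b w' where "w = u @ (x, b) # (x, \<not> b) # w'"
proof -
  have "\<exists>u x b w'. w = u @ (x, b) # (x, \<not> b) # w'"
    using assms unfolding reduced_def
  proof (induction w rule: induct_list012)
    case (3 p q w)
    show ?case
    proof (cases "fst p = fst q \<and> snd p \<noteq> snd q")
      case True
      then have "p # q # w = [] @ (fst p, snd p) # (fst p, \<not> snd p) # w"
        by (cases p; cases q) auto
      then show ?thesis by blast
    next
      case False
      then obtain u x b w' where "q # w = u @ (x, b) # (x, \<not> b) # w'"
        using 3 by auto
      then have "p # q # w = (p # u) @ (x, b) # (x, \<not> b) # w'" by simp
      then show ?thesis by blast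
    qed
  qed auto
  then show ?thesis using that by blast
qed

text \<open>By induction on the length: a non-empty relation between basis elements cannot be
  reduced, and deleting a cancelling pair changes its value neither in \<open>F\<close> nor in
  \<open>E\<close>. So every relation reduces to the empty word.\<close>

lemma free_basis_relation_trivial:
  assumes "group F" "group E" "free_basis F X" "s \<in> X \<rightarrow> carrier E"
    and "fst ` set w \<subseteq> X" "word_value F (\<lambda>x. x) w = \<one>\<^bsub>F\<^esub>"
  shows "word_value E s w = \<one>\<^bsub>E\<^esub>"
  using assms(5,6)
proof (induction w rule: length_induct)
  case (1 w)
  interpret F: group F by fact
  interpret E: group E by fact
  have X: "X \<subseteq> carrier F" using assms(3) by (simp add: free_basis_def)
  show ?case
  proof (cases "reduced w")
    case True
    then have "w = []" using 1 assms(3) unfolding free_basis_def by blast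
    then show ?thesis by simp
  next
    case False
    then obtain u x b w' where w: "w = u @ (x, b) # (x, \<not> b) # w'"
      by (rule not_reducedE)
    have "word_value F (\<lambda>x. x) w = word_value F (\<lambda>x. x) (u @ w')"
      unfolding w by (rule F.word_value_cancel) (use 1 X in \<open>auto simp: w\<close>)
    moreover have "word_value E s w = word_value E s (u @ w')"
      unfolding w by (rule E.word_value_cancel) (use 1 assms(4) in \<open>auto simp: w\<close>)
    ultimately show ?thesis
      using 1 by (auto simp: w)
  qed
qed

text \<open>This recovers the universal property from the internal definition of freeness, for
  target groups of any type. Each element of \<open>F\<close> is written as a word in the basis, and
  the word is evaluated in \<open>E\<close> along \<open>s\<close>.\<close>

lemma free_basis_extend:
  fixes F :: "('f, 'm) monoid_scheme"
  assumes "group F" "group E" "free_basis F X" "s \<in> X \<rightarrow> carrier E"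
  obtains \<theta> where "\<theta> \<in> hom F E" "\<And>x. x \<in> X \<Longrightarrow> \<theta> x = s x"
proof -
  interpret F: group F by fact
  interpret E: group E by fact
  have X: "X \<subseteq> carrier F" "generate F X = carrier F"
    using assms(3) by (simp_all add: free_basis_def)
  have "\<forall>y\<in>carrier F. \<exists>w. fst ` set w \<subseteq> X \<and> word_value F (\<lambda>x. x) w = y"
    using F.generate_eq_word_value X by blast
  then obtain W where W: "\<And>y. y \<in> carrier F \<Longrightarrow> fst ` set (W y) \<subseteq> X"
    "\<And>y. y \<in> carrier F \<Longrightarrow> word_value F (\<lambda>x. x) (W y) = y"
    by metis
  define \<theta> where "\<theta> y = word_value E s (W y)" for y
  have cF: "\<And>x. x \<in> fst ` set w \<Longrightarrow> x \<in> carrier F" if "fst ` set w \<subseteq> X" for w :: "'f gword"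
    using that X by blast
  have cE: "\<And>x. x \<in> fst ` set w \<Longrightarrow> s x \<in> carrier E" if "fst ` set w \<subseteq> X" for w :: "'f gword"
    using that assms(4) by blast
  \<comment> \<open>The value does not depend on the chosen word: two words for \<open>y\<close>
    differ by the relation \<open>?u\<close>, which is also trivial in \<open>E\<close>.
    Multiplicativity of \<open>\<theta>\<close> follows by concatenating words.\<close>
  have \<theta>: "\<theta> y = word_value E s w"
    if "y \<in> carrier F" "fst ` set w \<subseteq> X" "word_value F (\<lambda>x. x) w = y" for y w
  proof -
    let ?u = "W y @ inv_word w"
    have l: "fst ` set ?u \<subseteq> X"
      using W(1)[OF that(1)] that(2) inv_word_letters[of w] by (simp add: image_Un)
    have "word_value F (\<lambda>x. x) ?u = y \<otimes>\<^bsub>F\<^esub> inv\<^bsub>F\<^esub> y"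
      using F.word_value_append[of "W y" "inv_word w" "\<lambda>x. x", OF cF[OF l]]
        F.word_value_inv_word[of w "\<lambda>x. x", OF cF[OF that(2)]] W(2)[OF that(1)] that(3) by simp
    then have "word_value E s ?u = \<one>\<^bsub>E\<^esub>"
      using free_basis_relation_trivial[OF assms l] that(1) by simp
    then have "\<theta> y \<otimes>\<^bsub>E\<^esub> inv\<^bsub>E\<^esub> (word_value E s w) = \<one>\<^bsub>E\<^esub>"
      using E.word_value_append[of "W y" "inv_word w" s, OF cE[OF l]]
        E.word_value_inv_word[of w s, OF cE[OF that(2)]] by (simp add: \<theta>_def)
    moreover have "\<theta> y \<in> carrier E"
      unfolding \<theta>_def by (rule E.word_value_closed[OF cE[OF W(1)[OF that(1)]]])
    moreover have "word_value E s w \<in> carrier E"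
      by (rule E.word_value_closed[OF cE[OF that(2)]])
    ultimately show ?thesis
      using E.inv_solve_right[of "\<one>\<^bsub>E\<^esub>" "\<theta> y" "word_value E s w"] by simp
  qed
  have "\<theta> \<in> hom F E"
  proof (rule homI)
    fix y assume "y \<in> carrier F"
    then show "\<theta> y \<in> carrier E"
      unfolding \<theta>_def by (intro E.word_value_closed[OF cE[OF W(1)]])
  next
    fix y z assume yz: "y \<in> carrier F" "z \<in> carrier F"
    have l: "fst ` set (W y @ W z) \<subseteq> X" using W(1) yz by (simp add: image_Un)
    have "word_value F (\<lambda>x. x) (W y @ W z) = y \<otimes>\<^bsub>F\<^esub> z"
      using F.word_value_append[of "W y" "W z" "\<lambda>x. x", OF cF[OF l]] W(2) yz by simp
    then have "\<theta> (y \<otimes>\<^bsub>F\<^esub> z) = word_value E s (W y @ W z)"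
      using \<theta> l yz by simp
    then show "\<theta> (y \<otimes>\<^bsub>F\<^esub> z) = \<theta> y \<otimes>\<^bsub>E\<^esub> \<theta> z"
      using E.word_value_append[of "W y" "W z" s, OF cE[OF l]] by (simp add: \<theta>_def)
  qed
  moreover have "\<theta> x = s x" if "x \<in> X" for x
  proof -
    have "x \<in> carrier F" "s x \<in> carrier E" using that X assms(4) by auto
    then show ?thesis using \<theta>[of x "[(x, True)]"] that by simp
  qed
  ultimately show ?thesis using that by blast
qed

lemma (in group_hom) hom_eq_on_generate:
  assumes "group_hom G H k" "T \<subseteq> carrier G" "\<And>x. x \<in> T \<Longrightarrow> h x = k x" "y \<in> generate G T"
  shows "h y = k y"
proof -
  interpret k: group_hom G H k by fact
  obtain w where w: "fst ` set w \<subseteq> T" "word_value G (\<lambda>x. x) w = y"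
    using G.generate_eq_word_value assms by blast
  have "word_value H h w = word_value H k w"
    by (rule word_value_cong) (use w assms in auto)
  moreover have "\<And>x. x \<in> fst ` set w \<Longrightarrow> x \<in> carrier G"
    using w assms by blast
  ultimately show ?thesis
    using word_value_hom[of w "\<lambda>x. x"] k.word_value_hom[of w "\<lambda>x. x"] w(2) by simp
qed

text \<open>Free groups are projective: send each basis element to a \<open>\<psi>\<close>-preimage
  of its image under \<open>\<pi>\<close> and extend. The homomorphisms
  \<open>\<psi> \<circ> \<theta>\<close> and \<open>\<pi>\<close> agree on the basis, hence
  everywhere.\<close>

lemma free_presentation_lift:
  assumes "free_presentation F \<pi> G" "group G" "group E" "\<psi> \<in> epi E G"
  obtains \<theta> where "\<theta> \<in> hom F E" "\<And>x. x \<in> carrier F \<Longrightarrow> \<psi> (\<theta> x) = \<pi> x"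
proof -
  obtain X where F: "group F" and X: "free_basis F X" and \<pi>: "\<pi> \<in> epi F G"
    using assms(1) by (auto simp: free_presentation_def)
  have X': "X \<subseteq> carrier F" "generate F X = carrier F"
    using X by (simp_all add: free_basis_def)
  have "\<exists>e\<in>carrier E. \<psi> e = \<pi> x" if "x \<in> X" for x
  proof -
    have "\<pi> x \<in> carrier G" using that X' \<pi> by (auto simp: epi_def hom_def)
    then show ?thesis using assms(4) by (force simp: epi_def)
  qed
  then obtain s where s: "\<And>x. x \<in> X \<Longrightarrow> s x \<in> carrier E" "\<And>x. x \<in> X \<Longrightarrow> \<psi> (s x) = \<pi> x"
    by metis
  then obtain \<theta> where \<theta>: "\<theta> \<in> hom F E" "\<And>x. x \<in> X \<Longrightarrow> \<theta> x = s x"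
    using free_basis_extend[OF F assms(3) X] by blast
  interpret h: group_hom F G "\<psi> \<circ> \<theta>"
    using F assms \<theta>(1) by (auto simp: group_hom_def group_hom_axioms_def epi_def intro: hom_compose)
  have "group_hom F G \<pi>"
    using F assms(2) \<pi> by (auto simp: group_hom_def group_hom_axioms_def epi_def)
  then have "\<psi> (\<theta> x) = \<pi> x" if "x \<in> carrier F" for x
    using h.hom_eq_on_generate[of \<pi> X x] X' \<theta> s that by auto
  with \<theta>(1) show ?thesis using that by blast
qed

section \<open>Cardinality of generated subgroups\<close>

lemma infinite_times_lepoll:
  assumes "infinite (UNIV :: 'e set)" "S \<lesssim> (UNIV :: 'e set)" "T \<lesssim> (UNIV :: 'e set)"
  shows "S \<times> T \<lesssim> (UNIV :: 'e set)"
proof -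
  have "(UNIV :: 'e set) \<times> (UNIV :: 'e set) \<approx> (UNIV :: 'e set)"
    using card_of_Times_same_infinite[OF assms(1)] by (simp add: eqpoll_iff_card_of_ordIso)
  then show ?thesis
    using times_lepoll_mono[OF assms(2,3)] lepoll_trans2 by blast
qed

text \<open>Folding an injective pairing on \<open>'e\<close> codes the lists of any fixed length by
  single elements. Pairing the code with the length separates all lists.\<close>

lemma infinite_lists_lepoll:
  assumes inf: "infinite (UNIV :: 'e set)" and "S \<lesssim> (UNIV :: 'e set)"
  shows "lists S \<lesssim> (UNIV :: 'e set)"
proof -
  have "(UNIV :: ('e \<times> 'e) set) \<lesssim> (UNIV :: 'e set)"
    using infinite_times_lepoll[OF inf lepoll_refl lepoll_refl] by simp
  then obtain p :: "'e \<times> 'e \<Rightarrow> 'e" where p: "inj p" unfolding lepoll_def by blast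
  \<comment> \<open>The empty list gets the arbitrary code \<open>undefined\<close>. A clash with
    the code of a longer list is harmless, since codes are compared only for lists of equal
    length.\<close>
  define enc :: "'e list \<Rightarrow> 'e" where "enc xs = foldr (\<lambda>x y. p (x, y)) xs undefined" for xs
  have enc: "xs = ys" if "length xs = length ys" "enc xs = enc ys" for xs ys :: "'e list"
    using that
  proof (induction rule: list_induct2)
    case (Cons x xs y ys)
    from Cons.prems have "p (x, enc xs) = p (y, enc ys)" by (simp add: enc_def)
    then have "(x, enc xs) = (y, enc ys)" by (rule injD[OF p])
    with Cons.IH show ?case by simp
  qed simp
  have "inj (\<lambda>xs. (length xs, enc xs))"
  proof (rule injI)
    fix xs ys :: "'e list" assume "(length xs, enc xs) = (length ys, enc ys)"
    then show "xs = ys" by (intro enc) simp_all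
  qed
  then have "(UNIV :: 'e list set) \<lesssim> (UNIV :: nat set) \<times> (UNIV :: 'e set)"
    unfolding lepoll_def by blast
  also have "\<dots> \<lesssim> (UNIV :: 'e set)"
    by (rule infinite_times_lepoll[OF inf infinite_le_lepoll[THEN iffD1, OF inf] lepoll_refl])
  finally have "(UNIV :: 'e list set) \<lesssim> (UNIV :: 'e set)" .
  then show ?thesis
    using lists_lepoll_mono[OF assms(2)] lepoll_trans unfolding lists_UNIV by blast
qed

lemma (in group) generate_lepoll:
  assumes inf: "infinite (UNIV :: 'e set)" and "T \<subseteq> carrier G" "T \<lesssim> (UNIV :: 'e set)"
  shows "generate G T \<lesssim> (UNIV :: 'e set)"
proof -
  have "generate G T \<subseteq> word_value G (\<lambda>x. x) ` lists (T \<times> (UNIV :: bool set))"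
  proof
    fix y assume "y \<in> generate G T"
    then obtain w where "fst ` set w \<subseteq> T" "word_value G (\<lambda>x. x) w = y"
      using generate_eq_word_value assms(2) by blast
    then show "y \<in> word_value G (\<lambda>x. x) ` lists (T \<times> (UNIV :: bool set))"
      by (intro image_eqI[of _ _ w]) (auto simp: lists_eq_set)
  qed
  then have "generate G T \<lesssim> lists (T \<times> (UNIV :: bool set))"
    by (rule subset_image_lepoll)
  also have "\<dots> \<lesssim> (UNIV :: 'e set)"
    by (intro infinite_lists_lepoll infinite_times_lepoll inf assms(3)
        finite_lepoll_infinite) auto
  finally show ?thesis .
qed

section \<open>Marginal subgroups\<close>

lemma marginalI:
  assumes "a \<in> carrier G"
    and "\<And>v g i. v \<in> V \<Longrightarrow> g \<in> UNIV \<rightarrow> carrier G \<Longrightarrow>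
      word_value G (g(i := g i \<otimes>\<^bsub>G\<^esub> a)) v = word_value G g v"
  shows "a \<in> marginal V G"
  using assms by (simp add: marginal_def)

lemma marginal_carrier: "a \<in> marginal V G \<Longrightarrow> a \<in> carrier G"
  by (simp add: marginal_def)

lemma marginal_word_value:
  assumes "a \<in> marginal V G" "v \<in> V" "g \<in> UNIV \<rightarrow> carrier G"
  shows "word_value G (g(i := g i \<otimes>\<^bsub>G\<^esub> a)) v = word_value G g v"
  using assms by (simp add: marginal_def)

context group
begin

lemma word_value_UNIV_closed: "g \<in> UNIV \<rightarrow> carrier G \<Longrightarrow> word_value G g w \<in> carrier G"
  by (rule word_value_closed) auto

lemma word_value_conj:
  assumes "g \<in> UNIV \<rightarrow> carrier G" "h \<in> carrier G"
  shows "word_value G (\<lambda>x. h \<otimes> g x \<otimes> inv h) w = h \<otimes> word_value G g w \<otimes> inv h"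
proof -
  have "inv h \<otimes> (h \<otimes> x) = x" if "x \<in> carrier G" for x
    using that assms(2) by (simp flip: m_assoc)
  then interpret c: group_hom G G "\<lambda>x. h \<otimes> x \<otimes> inv h"
    using assms(2) by unfold_locales (auto intro!: homI simp: m_assoc)
  show ?thesis using c.word_value_hom[of w g] assms(1) by (simp add: Pi_iff)
qed

lemma marginal_subgroup: "subgroup (marginal V G) G"
proof (rule subgroupI)
  show "marginal V G \<subseteq> carrier G" by (auto intro: marginal_carrier)
  have "\<one> \<in> marginal V G"
    by (rule marginalI) (auto simp: Pi_iff)
  then show "marginal V G \<noteq> {}" by blast
next
  fix a assume a: "a \<in> marginal V G"
  note ac = marginal_carrier[OF a]
  show "inv a \<in> marginal V G"
  proof (rule marginalI)
    fix v i and g :: "nat \<Rightarrow> 'a" assume v: "v \<in> V" and g: "g \<in> UNIV \<rightarrow> carrier G"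
    have gc: "g i \<in> carrier G" using g by auto
    \<comment> \<open>Marginality of \<open>a\<close> is applied at the tuple already changed by
      \<open>inv a\<close>; multiplying its entry by \<open>a\<close> gives back
      \<open>g\<close>.\<close>
    let ?g = "g(i := g i \<otimes> inv a)"
    have "?g \<in> UNIV \<rightarrow> carrier G" using g ac gc by auto
    then have "word_value G (?g(i := ?g i \<otimes> a)) v = word_value G ?g v"
      by (rule marginal_word_value[OF a v])
    moreover have "?g(i := ?g i \<otimes> a) = g" using ac gc by (auto simp: m_assoc)
    ultimately show "word_value G ?g v = word_value G g v" by simp
  qed (use ac in simp)
next
  fix a b assume a: "a \<in> marginal V G" and b: "b \<in> marginal V G"
  note ac = marginal_carrier[OF a] marginal_carrier[OF b]
  show "a \<otimes> b \<in> marginal V G"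
  proof (rule marginalI)
    fix v i and g :: "nat \<Rightarrow> 'a" assume v: "v \<in> V" and g: "g \<in> UNIV \<rightarrow> carrier G"
    have gc: "g i \<in> carrier G" using g by auto
    let ?g = "g(i := g i \<otimes> a)"
    have "?g \<in> UNIV \<rightarrow> carrier G" using g ac gc by auto
    then have "word_value G (?g(i := ?g i \<otimes> b)) v = word_value G ?g v"
      by (rule marginal_word_value[OF b v])
    moreover have "word_value G ?g v = word_value G g v"
      by (rule marginal_word_value[OF a v g])
    moreover have "?g(i := ?g i \<otimes> b) = g(i := g i \<otimes> (a \<otimes> b))"
      using ac gc by (auto simp: m_assoc)
    ultimately show "word_value G (g(i := g i \<otimes> (a \<otimes> b))) v = word_value G g v" by simp
  qed (use ac in simp)
qed

lemma marginal_normal: "marginal V G \<lhd> G"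
proof (rule normal_invI[OF marginal_subgroup])
  fix h a assume h: "h \<in> carrier G" and a: "a \<in> marginal V G"
  note ac = marginal_carrier[OF a]
  show "h \<otimes> a \<otimes> inv h \<in> marginal V G"
  proof (rule marginalI)
    fix v i and g :: "nat \<Rightarrow> 'a" assume v: "v \<in> V" and g: "g \<in> UNIV \<rightarrow> carrier G"
    have gc: "g j \<in> carrier G" for j using g by auto
    \<comment> \<open>Conjugation by \<open>h\<close> takes \<open>k\<close> to \<open>g\<close>,
      and takes \<open>k i \<otimes> a\<close> to \<open>g i\<close> times the conjugate of
      \<open>a\<close>. So the claim for the conjugate at \<open>g\<close> reduces to the
      marginality of \<open>a\<close> at \<open>k\<close>.\<close>
    define k where "k j = inv h \<otimes> g j \<otimes> h" for j
    have k: "k \<in> UNIV \<rightarrow> carrier G" using gc h by (auto simp: k_def)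
    have [simp]: "inv h \<otimes> (h \<otimes> x) = x" "h \<otimes> (inv h \<otimes> x) = x" if "x \<in> carrier G" for x
      using that h by (simp_all flip: m_assoc)
    have kg: "h \<otimes> k j \<otimes> inv h = g j" for j
      using gc h by (simp add: k_def m_assoc)
    let ?k = "k(i := k i \<otimes> a)"
    have kg': "(\<lambda>j. h \<otimes> ?k j \<otimes> inv h) = g(i := g i \<otimes> (h \<otimes> a \<otimes> inv h))"
    proof
      fix j
      show "h \<otimes> ?k j \<otimes> inv h = (g(i := g i \<otimes> (h \<otimes> a \<otimes> inv h))) j"
        using kg[of j] gc[of i] h ac by (auto simp: m_assoc k_def)
    qed
    have "?k \<in> UNIV \<rightarrow> carrier G" using k ac by (simp add: Pi_iff)
    then have "word_value G (g(i := g i \<otimes> (h \<otimes> a \<otimes> inv h))) v = h \<otimes> word_value G ?k v \<otimes> inv h"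
      using word_value_conj[of ?k h v] h unfolding kg' by simp
    also have "\<dots> = h \<otimes> word_value G k v \<otimes> inv h"
      by (simp add: marginal_word_value[OF a v k])
    also have "\<dots> = word_value G g v"
      using word_value_conj[OF k h, of v] by (simp add: kg)
    finally show "word_value G (g(i := g i \<otimes> (h \<otimes> a \<otimes> inv h))) v = word_value G g v" .
  qed (use h ac in simp)
qed

lemma one_marginal: "\<one> \<in> marginal V G"
  by (rule subgroup.one_closed[OF marginal_subgroup])

text \<open>The definition of \<open>marginal\<close> changes one variable at a time. Induction
  changes finitely many, and a word contains only finitely many variables.\<close>

lemma word_value_mult_marginal:
  assumes f: "f \<in> UNIV \<rightarrow> carrier G" and k: "\<And>j. k j \<in> marginal V G" and v: "v \<in> V"
  shows "word_value G (\<lambda>j. f j \<otimes> k j) v = word_value G f v"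
proof -
  have fin: "word_value G (\<lambda>j. if j \<in> I then f j \<otimes> k j else f j) v = word_value G f v"
    if "finite I" for I
    using that
  proof (induction I)
    case (insert i I)
    let ?g = "\<lambda>j. if j \<in> I then f j \<otimes> k j else f j"
    have "?g \<in> UNIV \<rightarrow> carrier G" using f marginal_carrier[OF k] by (simp add: Pi_iff)
    then have "word_value G (?g(i := ?g i \<otimes> k i)) v = word_value G ?g v"
      by (rule marginal_word_value[OF k v])
    moreover have "?g(i := ?g i \<otimes> k i) = (\<lambda>j. if j \<in> insert i I then f j \<otimes> k j else f j)"
      using insert.hyps by auto
    ultimately show ?case using insert.IH by simp
  qed simp
  have "word_value G (\<lambda>j. f j \<otimes> k j) v
      = word_value G (\<lambda>j. if j \<in> fst ` set v then f j \<otimes> k j else f j) v"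
    by (rule word_value_cong) simp
  then show ?thesis using fin[of "fst ` set v"] by simp
qed

lemma marginal_Int_subgroup:
  assumes "subgroup H G"
  shows "marginal V G \<inter> H \<subseteq> marginal V (G\<lparr>carrier := H\<rparr>)"
proof
  fix a assume a: "a \<in> marginal V G \<inter> H"
  show "a \<in> marginal V (G\<lparr>carrier := H\<rparr>)"
  proof (rule marginalI)
    fix v i and g :: "nat \<Rightarrow> 'a" assume v: "v \<in> V" and "g \<in> UNIV \<rightarrow> carrier (G\<lparr>carrier := H\<rparr>)"
    then have g: "g j \<in> H" for j by auto
    have "g \<in> UNIV \<rightarrow> carrier G" using g subgroup.mem_carrier[OF assms] by auto
    then have "word_value G (g(i := g i \<otimes> a)) v = word_value G g v"
      using a v by (intro marginal_word_value) auto
    moreover have "(g(i := g i \<otimes> a)) j \<in> H" for j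
      using g a subgroup.m_closed[OF assms] by auto
    ultimately show "word_value (G\<lparr>carrier := H\<rparr>) (g(i := g i \<otimes>\<^bsub>G\<lparr>carrier := H\<rparr>\<^esub> a)) v
        = word_value (G\<lparr>carrier := H\<rparr>) g v"
      using g by (simp add: word_value_subgroup[OF assms])
  qed (use a in simp)
qed

end

lemma (in group_hom) marginal_image:
  assumes surj: "h ` carrier G = carrier H" and a: "a \<in> marginal V G"
  shows "h a \<in> marginal V H"
proof (rule marginalI)
  note ac = marginal_carrier[OF a]
  show "h a \<in> carrier H" using ac by simp
  fix v i and g :: "nat \<Rightarrow> 'c" assume v: "v \<in> V" and g: "g \<in> UNIV \<rightarrow> carrier H"
  have "\<forall>j. \<exists>x\<in>carrier G. h x = g j" using g surj by (metis Pi_iff UNIV_I imageE)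
  then obtain f where f: "\<And>j. f j \<in> carrier G" "\<And>j. h (f j) = g j" by metis
  have "(\<lambda>j. h ((f(i := f i \<otimes>\<^bsub>G\<^esub> a)) j)) = g(i := g i \<otimes>\<^bsub>H\<^esub> h a)"
    using f ac by auto
  then have "word_value H (g(i := g i \<otimes>\<^bsub>H\<^esub> h a)) v = h (word_value G (f(i := f i \<otimes>\<^bsub>G\<^esub> a)) v)"
    using word_value_hom[of v "f(i := f i \<otimes>\<^bsub>G\<^esub> a)"] f ac by auto
  also have "\<dots> = h (word_value G f v)"
    using f by (subst marginal_word_value[OF a v]) auto
  also have "\<dots> = word_value H g v"
    using word_value_hom[of v f] f by simp
  finally show "word_value H (g(i := g i \<otimes>\<^bsub>H\<^esub> h a)) v = word_value H g v" .
qed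

lemma group_hom_epi: "group G \<Longrightarrow> group H \<Longrightarrow> h \<in> epi G H \<Longrightarrow> group_hom G H h"
  by (simp add: group_hom_def group_hom_axioms_def epi_def)

lemma marginal_epi:
  assumes "group G" "group H" "h \<in> epi G H"
  shows "h ` marginal V G \<subseteq> marginal V H"
  using group_hom.marginal_image[OF group_hom_epi[OF assms]] assms(3) by (auto simp: epi_def)

section \<open>Marginal extensions\<close>

text \<open>\<open>epimarginal\<close> and \<open>capable\<close> see only groups with elements in
  \<open>'e\<close>; groups constructed over other types are copied there along an
  injection.\<close>

lemma (in group) transport:
  fixes h :: "'a \<Rightarrow> 'e"
  assumes "inj_on h (carrier G)"
  obtains E :: "'e monoid" where "group E" "h \<in> iso G E"
proof -
  let ?r = "inv_into (carrier G) h"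
  define E where "E = \<lparr>carrier = h ` carrier G, mult = \<lambda>x y. h (?r x \<otimes> ?r y), one = h \<one>\<rparr>"
  have r: "?r (h x) = x" if "x \<in> carrier G" for x using that assms by simp
  have c: "carrier E = h ` carrier G" and o: "\<one>\<^bsub>E\<^esub> = h \<one>"
    and m: "\<And>x y. x \<in> carrier G \<Longrightarrow> y \<in> carrier G \<Longrightarrow> h x \<otimes>\<^bsub>E\<^esub> h y = h (x \<otimes> y)"
    using r by (auto simp: E_def)
  have "group E"
  proof (rule groupI)
    fix x assume "x \<in> carrier E"
    then obtain x' where "x' \<in> carrier G" "x = h x'" by (auto simp: c)
    then have "h (inv x') \<in> carrier E" "h (inv x') \<otimes>\<^bsub>E\<^esub> x = \<one>\<^bsub>E\<^esub>" by (auto simp: c m o)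
    then show "\<exists>y\<in>carrier E. y \<otimes>\<^bsub>E\<^esub> x = \<one>\<^bsub>E\<^esub>" by blast
  qed (auto simp: c o m m_assoc)
  moreover have "h \<in> iso G E"
    using assms by (auto simp: iso_def hom_def bij_betw_def c m)
  ultimately show ?thesis using that by blast
qed

text \<open>This is the condition on \<open>E\<close> and \<open>\<psi>\<close> in
  \<open>epimarginal\<close>, with the element type of \<open>E\<close> left free so that quotients,
  subgroups and products of groups also qualify.\<close>

definition marginal_extension ::
    "nat gword set \<Rightarrow> ('e, 'k) monoid_scheme \<Rightarrow> ('e \<Rightarrow> 'g) \<Rightarrow> ('g, 'm) monoid_scheme \<Rightarrow> bool" where
  "marginal_extension V E \<psi> G \<longleftrightarrow> group E \<and> \<psi> \<in> epi E G \<and> kernel E G \<psi> \<subseteq> marginal V E"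

lemma epimarginal_mem_iff:
  "a \<in> epimarginal TYPE('e) V G \<longleftrightarrow>
    (\<forall>(E :: 'e monoid) \<psi>. marginal_extension V E \<psi> G \<longrightarrow> a \<in> \<psi> ` marginal V E)"
  unfolding epimarginal_def marginal_extension_def by blast

text \<open>Two elements with the same image differ by an element of the kernel, which is marginal.
  Hence marginality in \<open>E\<close> can be tested on images in \<open>G\<close>.\<close>

lemma marginal_extension_mem:
  assumes "group G" "marginal_extension V E \<psi> G" "e \<in> carrier E" "\<psi> e \<in> \<psi> ` marginal V E"
  shows "e \<in> marginal V E"
proof -
  interpret group_hom E G \<psi>
    using assms by (auto simp: marginal_extension_def intro: group_hom_epi)
  obtain m where m: "m \<in> marginal V E" "\<psi> e = \<psi> m" using assms(4) by blast
  note mc = marginal_carrier[OF m(1)]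
  have "\<psi> m \<in> carrier G" using mc by simp
  then have "inv\<^bsub>E\<^esub> m \<otimes>\<^bsub>E\<^esub> e \<in> kernel E G \<psi>"
    using assms(3) m(2) mc by (simp add: kernel_def)
  then have "inv\<^bsub>E\<^esub> m \<otimes>\<^bsub>E\<^esub> e \<in> marginal V E"
    using assms(2) by (auto simp: marginal_extension_def)
  then have "m \<otimes>\<^bsub>E\<^esub> (inv\<^bsub>E\<^esub> m \<otimes>\<^bsub>E\<^esub> e) \<in> marginal V E"
    using m(1) subgroup.m_closed[OF G.marginal_subgroup] by blast
  then show ?thesis using assms(3) mc by (simp flip: G.m_assoc)
qed

lemma epi_compose:
  assumes "h \<in> epi G H" "k \<in> epi H I"
  shows "k \<circ> h \<in> epi G I"
proof -
  have "(k \<circ> h) ` carrier G = carrier I"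
    using assms unfolding image_comp[symmetric] by (simp add: epi_def)
  then show ?thesis using assms hom_compose[of h G H k I] by (simp add: epi_def)
qed

lemma marginal_extension_transfer:
  assumes "group G" "marginal_extension V D \<phi> G" "group E" "j \<in> iso D E"
  obtains \<psi> where "marginal_extension V E \<psi> G" "\<psi> ` marginal V E \<subseteq> \<phi> ` marginal V D"
proof -
  interpret D: group D using assms by (simp add: marginal_extension_def)
  have \<phi>: "\<phi> \<in> epi D G" "kernel D G \<phi> \<subseteq> marginal V D"
    using assms by (auto simp: marginal_extension_def)
  define k where "k = inv_into (carrier D) j"
  have k: "k \<in> iso E D" unfolding k_def by (rule D.iso_set_sym[OF assms(4)])
  then have kh: "k \<in> epi E D" by (simp add: iso_iff_mon_epi)
  have jh: "j \<in> epi D E" using assms(4) by (simp add: iso_iff_mon_epi)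
  have jk: "j (k x) = x" if "x \<in> carrier E" for x
    using that assms(4) by (auto simp: k_def iso_def bij_betw_def f_inv_into_f)
  have "\<phi> \<circ> k \<in> epi E G"
    using epi_compose[OF kh \<phi>(1)] .
  moreover have "kernel E G (\<phi> \<circ> k) \<subseteq> marginal V E"
  proof
    fix x assume x: "x \<in> kernel E G (\<phi> \<circ> k)"
    then have xc: "x \<in> carrier E" by (simp add: kernel_def)
    then have "k x \<in> carrier D" using kh by (auto simp: epi_def)
    then have "k x \<in> marginal V D" using x \<phi>(2) by (auto simp: kernel_def)
    then show "x \<in> marginal V E"
      using marginal_epi[OF D.is_group assms(3) jh, of V] jk[OF xc] by force
  qed
  ultimately have "marginal_extension V E (\<phi> \<circ> k) G"
    using assms(3) by (simp add: marginal_extension_def)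
  moreover have "(\<phi> \<circ> k) ` marginal V E \<subseteq> \<phi> ` marginal V D"
    using marginal_epi[OF assms(3) D.is_group kh, of V] by (auto simp: image_comp[symmetric])
  ultimately show ?thesis using that by blast
qed

text \<open>One preimage of every element of \<open>G\<close>, together with witnesses for each of these preimages that
  is not marginal, generates a subgroup no larger than \<open>'e\<close>.\<close>

lemma marginal_extension_shrink:
  fixes G :: "('g, 'm) monoid_scheme" and Q :: "('q, 'k) monoid_scheme"
  assumes inf: "infinite (UNIV :: 'e set)" and le: "carrier G \<lesssim> (UNIV :: 'e set)"
    and G: "group G" and ext: "marginal_extension V Q \<psi> G"
  obtains E :: "'e monoid" and \<phi>
  where "marginal_extension V E \<phi> G" "\<phi> ` marginal V E \<subseteq> \<psi> ` marginal V Q"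
proof -
  interpret group_hom Q G \<psi>
    using ext G by (auto simp: marginal_extension_def intro: group_hom_epi)
  have surj: "\<psi> ` carrier Q = carrier G" and ker: "kernel Q G \<psi> \<subseteq> marginal V Q"
    using ext by (auto simp: marginal_extension_def epi_def)
  have "\<forall>z\<in>carrier G. \<exists>x\<in>carrier Q. \<psi> x = z" using surj by (metis imageE)
  then obtain s where s: "\<And>z. z \<in> carrier G \<Longrightarrow> s z \<in> carrier Q"
    "\<And>z. z \<in> carrier G \<Longrightarrow> \<psi> (s z) = z" by metis
  \<comment> \<open>A tuple \<open>g\<close> witnessing that \<open>s z\<close> is not marginal. If
    \<open>s z\<close> is marginal, the constant tuple of ones is a dummy, so that a single function
    \<open>w\<close> can be chosen for all \<open>z\<close>.\<close>
  have "\<exists>g. (\<forall>n. g n \<in> carrier Q) \<and> (s z \<in> marginal V Q \<or>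
      (\<exists>v\<in>V. \<exists>i. word_value Q (g(i := g i \<otimes>\<^bsub>Q\<^esub> s z)) v \<noteq> word_value Q g v))"
    if "z \<in> carrier G" for z
  proof (cases "s z \<in> marginal V Q")
    case True
    then show ?thesis by (intro exI[of _ "\<lambda>_. \<one>\<^bsub>Q\<^esub>"]) simp
  next
    case False
    then show ?thesis using s(1)[OF that] unfolding marginal_def by blast
  qed
  then obtain w :: "'g \<Rightarrow> nat \<Rightarrow> 'q" where w: "\<And>z n. z \<in> carrier G \<Longrightarrow> w z n \<in> carrier Q"
    "\<And>z. z \<in> carrier G \<Longrightarrow> s z \<in> marginal V Q \<or>
      (\<exists>v\<in>V. \<exists>i. word_value Q ((w z)(i := w z i \<otimes>\<^bsub>Q\<^esub> s z)) v \<noteq> word_value Q (w z) v)"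
    by metis
  \<comment> \<open>Index 0 contributes the preimage \<open>s z\<close>, and index
    \<open>Suc k\<close> the entry \<open>k\<close> of the witness tuple for
    \<open>z\<close>.\<close>
  define T where "T = (\<lambda>(z, n). case n of 0 \<Rightarrow> s z | Suc k \<Rightarrow> w z k) ` (carrier G \<times> UNIV)"
  have T: "T \<subseteq> carrier Q" using s(1) w(1) by (auto simp: T_def split: nat.split)
  have sT: "s z \<in> T" if "z \<in> carrier G" for z
    unfolding T_def using that by (intro image_eqI[of _ _ "(z, 0)"]) auto
  have wT: "w z k \<in> T" if "z \<in> carrier G" for z k
    unfolding T_def using that by (intro image_eqI[of _ _ "(z, Suc k)"]) auto
  have "T \<lesssim> carrier G \<times> (UNIV :: nat set)" unfolding T_def by (rule image_lepoll)
  also have "\<dots> \<lesssim> (UNIV :: 'e set)"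
    by (rule infinite_times_lepoll[OF inf le infinite_le_lepoll[THEN iffD1, OF inf]])
  finally have Tle: "T \<lesssim> (UNIV :: 'e set)" .
  define H where "H = generate Q T"
  define D where "D = Q\<lparr>carrier := H\<rparr>"
  have H: "subgroup H Q" unfolding H_def by (rule G.generate_is_subgroup[OF T])
  have TH: "T \<subseteq> H" by (auto simp: H_def intro: generate.incl)
  interpret D: group D unfolding D_def by (rule G.subgroup_imp_group[OF H])
  have [simp]: "carrier D = H" "monoid.mult D = monoid.mult Q" by (simp_all add: D_def)
  have Hc: "x \<in> carrier Q" if "x \<in> H" for x using subgroup.mem_carrier[OF H that] .
  have mD: "marginal V Q \<inter> H \<subseteq> marginal V D"
    unfolding D_def by (rule G.marginal_Int_subgroup[OF H])
  have extD: "marginal_extension V D \<psi> G"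
    unfolding marginal_extension_def
  proof (intro conjI)
    have "\<psi> ` H = carrier G"
    proof
      show "carrier G \<subseteq> \<psi> ` H"
        using s(2) sT TH by (metis image_eqI subset_iff)
    qed (use Hc in auto)
    then show "\<psi> \<in> epi D G" using Hc by (auto simp: epi_def hom_def)
    show "kernel D G \<psi> \<subseteq> marginal V D"
      using mD ker Hc by (auto simp: kernel_def)
  qed (rule D.is_group)
  have img: "\<psi> ` marginal V D \<subseteq> \<psi> ` marginal V Q"
  proof
    fix z assume z: "z \<in> \<psi> ` marginal V D"
    then have zc: "z \<in> carrier G" using Hc marginal_carrier[of _ V D] by auto
    \<comment> \<open>If \<open>s z\<close> were not marginal in \<open>Q\<close>, its witness
      tuple, which lies in \<open>H\<close>, would contradict this marginality in \<open>D\<close>,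
      since word values agree in \<open>D\<close> and \<open>Q\<close>.\<close>
    have "s z \<in> marginal V D"
      using marginal_extension_mem[OF G extD] sT[OF zc] TH z s(2)[OF zc] by auto
    then have "word_value D ((w z)(i := w z i \<otimes>\<^bsub>D\<^esub> s z)) v = word_value D (w z) v"
      if "v \<in> V" for v i
      using that wT[OF zc] TH by (intro marginal_word_value) auto
    moreover have "((w z)(i := w z i \<otimes>\<^bsub>Q\<^esub> s z)) n \<in> H" for i n
      using subsetD[OF TH wT[OF zc]] subsetD[OF TH sT[OF zc]] subgroup.m_closed[OF H] by simp
    moreover have "w z n \<in> H" for n using wT[OF zc] TH by auto
    ultimately have "word_value Q ((w z)(i := w z i \<otimes>\<^bsub>Q\<^esub> s z)) v = word_value Q (w z) v"
      if "v \<in> V" for v i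
      using that unfolding D_def by (simp add: G.word_value_subgroup[OF H])
    then have "s z \<in> marginal V Q" using w(2)[OF zc] by blast
    then show "z \<in> \<psi> ` marginal V Q" using s(2)[OF zc] by (metis image_eqI)
  qed
  have "H \<lesssim> (UNIV :: 'e set)" unfolding H_def by (rule G.generate_lepoll[OF inf T Tle])
  then obtain h :: "'q \<Rightarrow> 'e" where "inj_on h (carrier D)" by (auto simp: lepoll_def)
  then obtain E :: "'e monoid" where "group E" "h \<in> iso D E" by (rule D.transport)
  then obtain \<phi> where \<phi>: "marginal_extension V E \<phi> G" "\<phi> ` marginal V E \<subseteq> \<psi> ` marginal V D"
    using marginal_extension_transfer[OF G extD] by blast
  show ?thesis by (rule that[OF \<phi>(1) order_trans[OF \<phi>(2) img]])
qed

text \<open>The intersection defining \<open>epimarginal\<close> ranges over groups on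
  \<open>'e\<close> only. Shrinking an extension on any other type makes the intersection control
  its marginal subgroup as well.\<close>

lemma epimarginal_preimage:
  assumes "infinite (UNIV :: 'e set)" "carrier G \<lesssim> (UNIV :: 'e set)"
    and "group G" "marginal_extension V Q \<psi> G"
    and "e \<in> carrier Q" "\<psi> e \<in> epimarginal TYPE('e) V G"
  shows "e \<in> marginal V Q"
proof -
  obtain E :: "'e monoid" and \<phi>
    where "marginal_extension V E \<phi> G" "\<phi> ` marginal V E \<subseteq> \<psi> ` marginal V Q"
    by (rule marginal_extension_shrink[OF assms(1-4)])
  then have "\<psi> e \<in> \<psi> ` marginal V Q" using assms(6) unfolding epimarginal_mem_iff by blast
  then show ?thesis by (rule marginal_extension_mem[OF assms(3-5)])
qed

section \<open>The extension given by a free presentation\<close>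

lemma (in group) marginal_commutator_gens:
  fixes V :: "nat gword set"
  assumes "R \<subseteq> carrier G"
  shows "{word_value G (f(i := f i \<otimes> r)) v \<otimes> inv (word_value G f v) | f i r v.
        v \<in> V \<and> f \<in> UNIV \<rightarrow> carrier G \<and> r \<in> R} \<subseteq> carrier G"
proof clarify
  fix f :: "nat \<Rightarrow> 'a" and i r and v :: "nat gword"
  assume "f \<in> UNIV \<rightarrow> carrier G" "r \<in> R"
  then have "f(i := f i \<otimes> r) \<in> UNIV \<rightarrow> carrier G" "f \<in> UNIV \<rightarrow> carrier G"
    using assms by (auto simp: Pi_iff)
  then show "word_value G (f(i := f i \<otimes> r)) v \<otimes> inv (word_value G f v) \<in> carrier G"
    by (simp add: word_value_UNIV_closed)
qed

text \<open>A conjugate of a generator is again a generator: conjugate the tuple \<open>f\<close>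
  and the element \<open>r\<close>, which stays in the normal subgroup \<open>R\<close>.\<close>

lemma (in group) marginal_commutator_normal:
  assumes "R \<lhd> G"
  shows "marginal_commutator V G R \<lhd> G"
  unfolding marginal_commutator_def
proof (rule normal_generateI)
  have R: "R \<subseteq> carrier G" using assms normal_imp_subgroup subgroup.subset by blast
  then show "{word_value G (f(i := f i \<otimes> r)) v \<otimes> inv (word_value G f v) | f i r v.
        v \<in> V \<and> f \<in> UNIV \<rightarrow> carrier G \<and> r \<in> R} \<subseteq> carrier G"
    by (rule marginal_commutator_gens)
  fix c h
  assume "c \<in> {word_value G (f(i := f i \<otimes> r)) v \<otimes> inv (word_value G f v) | f i r v.
        v \<in> V \<and> f \<in> UNIV \<rightarrow> carrier G \<and> r \<in> R}" and h: "h \<in> carrier G"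
  then obtain f i r v where c: "c = word_value G (f(i := f i \<otimes> r)) v \<otimes> inv (word_value G f v)"
    and v: "v \<in> V" and f: "f \<in> UNIV \<rightarrow> carrier G" and r: "r \<in> R" by blast
  have rc: "r \<in> carrier G" using r R by blast
  let ?f = "f(i := f i \<otimes> r)" and ?r = "h \<otimes> r \<otimes> inv h"
  let ?k = "\<lambda>j. h \<otimes> f j \<otimes> inv h"
  have f': "?f \<in> UNIV \<rightarrow> carrier G" using f rc by (simp add: Pi_iff)
  have k: "?k \<in> UNIV \<rightarrow> carrier G" using f h by (simp add: Pi_iff)
  have [simp]: "inv h \<otimes> (h \<otimes> x) = x" if "x \<in> carrier G" for x
    using that h by (simp flip: m_assoc)
  have fc: "f j \<in> carrier G" for j using f by auto
  have eq: "(\<lambda>j. h \<otimes> ?f j \<otimes> inv h) = ?k(i := ?k i \<otimes> ?r)"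
    using fc rc h by (auto simp: m_assoc)
  have wc: "word_value G f v \<in> carrier G" "word_value G ?f v \<in> carrier G"
    using f f' by (auto intro: word_value_UNIV_closed)
  have "h \<otimes> c \<otimes> inv h =
      (h \<otimes> word_value G ?f v \<otimes> inv h) \<otimes> inv (h \<otimes> word_value G f v \<otimes> inv h)"
    using wc h unfolding c by (simp add: m_assoc inv_mult_group)
  also have "\<dots> = word_value G (?k(i := ?k i \<otimes> ?r)) v \<otimes> inv (word_value G ?k v)"
    using word_value_conj[OF f' h, of v] word_value_conj[OF f h, of v] unfolding eq by simp
  finally have "h \<otimes> c \<otimes> inv h =
    word_value G (?k(i := ?k i \<otimes> ?r)) v \<otimes> inv (word_value G ?k v)" .
  moreover have "?r \<in> R" using normal_invE(2)[OF assms h r] .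
  ultimately show "h \<otimes> c \<otimes> inv h \<in>
      {word_value G (f(i := f i \<otimes> r)) v \<otimes> inv (word_value G f v) | f i r v.
        v \<in> V \<and> f \<in> UNIV \<rightarrow> carrier G \<and> r \<in> R}"
    using k v by blast
qed

lemma (in group) marginal_commutator_marginal:
  assumes "R \<subseteq> marginal V G"
  shows "marginal_commutator V G R \<subseteq> {\<one>}"
  unfolding marginal_commutator_def
proof (rule generate_subgroup_incl[OF _ triv_subgroup])
  show "{word_value G (f(i := f i \<otimes> r)) v \<otimes> inv (word_value G f v) | f i r v.
        v \<in> V \<and> f \<in> UNIV \<rightarrow> carrier G \<and> r \<in> R} \<subseteq> {\<one>}"
  proof clarify
    fix f :: "nat \<Rightarrow> 'a" and i r v
    assume "v \<in> V" "f \<in> UNIV \<rightarrow> carrier G" "r \<in> R"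
    then show "word_value G (f(i := f i \<otimes> r)) v \<otimes> inv (word_value G f v) = \<one>"
      using assms by (subst marginal_word_value) (auto intro: r_inv word_value_UNIV_closed)
  qed
qed

lemma (in group_hom) hom_marginal_commutator:
  assumes R: "R \<subseteq> carrier G" and S: "S \<subseteq> carrier H" "h ` R \<subseteq> S"
  shows "h ` marginal_commutator V G R \<subseteq> marginal_commutator V H S"
proof -
  let ?X = "{word_value G (f(i := f i \<otimes> r)) v \<otimes> inv (word_value G f v) | f i r v.
        v \<in> V \<and> f \<in> UNIV \<rightarrow> carrier G \<and> r \<in> R}"
  \<comment> \<open>The preimage of the target is a subgroup, so it suffices that it contains the
    generators \<open>?X\<close>; each of these is mapped to a generator for
    \<open>S\<close>.\<close>
  let ?K = "{x \<in> carrier G. h x \<in> marginal_commutator V H S}"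
  have N: "subgroup (marginal_commutator V H S) H"
    unfolding marginal_commutator_def
    by (rule H.generate_is_subgroup[OF H.marginal_commutator_gens[OF S(1)]])
  have "subgroup ?K G"
    using subgroup.m_closed[OF N] subgroup.m_inv_closed[OF N] subgroup.one_closed[OF N]
    by (intro G.subgroupI) auto
  moreover have "?X \<subseteq> ?K"
  proof
    fix c assume "c \<in> ?X"
    then obtain f i r v where c: "c = word_value G (f(i := f i \<otimes> r)) v \<otimes> inv (word_value G f v)"
      and v: "v \<in> V" and f: "f \<in> UNIV \<rightarrow> carrier G" and r: "r \<in> R" by blast
    let ?f = "f(i := f i \<otimes> r)" and ?k = "\<lambda>j. h (f j)"
    have fc: "f j \<in> carrier G" for j using f by auto
    have rc: "r \<in> carrier G" using r R by blast
    have f': "?f j \<in> carrier G" for j using fc rc by simp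
    have eq: "(\<lambda>j. h (?f j)) = ?k(i := ?k i \<otimes>\<^bsub>H\<^esub> h r)" using fc rc by auto
    have wc: "word_value G f v \<in> carrier G" "word_value G ?f v \<in> carrier G"
      using fc f' by (auto intro!: G.word_value_UNIV_closed)
    have "h c = word_value H (?k(i := ?k i \<otimes>\<^bsub>H\<^esub> h r)) v \<otimes>\<^bsub>H\<^esub> inv\<^bsub>H\<^esub> (word_value H ?k v)"
      unfolding c using wc word_value_hom[of v f] word_value_hom[of v ?f] fc f' unfolding eq by simp
    moreover have "?k \<in> UNIV \<rightarrow> carrier H" using fc by simp
    moreover have "h r \<in> S" using r S(2) by blast
    ultimately have "h c \<in> marginal_commutator V H S"
      unfolding marginal_commutator_def using v by (intro generate.incl) blast
    moreover have "c \<in> carrier G" unfolding c using wc by simp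
    ultimately show "c \<in> ?K" by simp
  qed
  ultimately have "generate G ?X \<subseteq> ?K" by (intro G.generate_subgroup_incl)
  then show ?thesis unfolding marginal_commutator_def[of V G R] by blast
qed

text \<open>Tuples of cosets are represented by tuples in \<open>G\<close>, and two cosets coincide
  when the quotient of their representatives lies in \<open>H\<close>. This turns marginality modulo
  \<open>H\<close> into a statement about word values in \<open>G\<close>.\<close>

lemma (in normal) marginal_Mod_iff:
  assumes x: "x \<in> carrier G"
  shows "H #> x \<in> marginal V (G Mod H) \<longleftrightarrow>
    (\<forall>v\<in>V. \<forall>f \<in> UNIV \<rightarrow> carrier G. \<forall>i.
      word_value G (f(i := f i \<otimes> x)) v \<otimes> inv (word_value G f v) \<in> H)" (is "?l \<longleftrightarrow> ?r")
proof -
  interpret q: group_hom G "G Mod H" "\<lambda>a. H #> a"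
    by (simp add: group_hom_def group_hom_axioms_def is_group factorgroup_is_group r_coset_hom_Mod)
  have eq_iff: "H #> a = H #> b \<longleftrightarrow> a \<otimes> inv b \<in> H" if "a \<in> carrier G" "b \<in> carrier G" for a b
    using that rcos_module[OF is_group, of b a] repr_independence[of a H b]
      repr_independenceD[of H a b] subgroup_axioms by metis
  have key: "word_value (G Mod H) ((\<lambda>j. H #> f j)(i := (H #> f i) \<otimes>\<^bsub>G Mod H\<^esub> (H #> x))) v
        = word_value (G Mod H) (\<lambda>j. H #> f j) v
      \<longleftrightarrow> word_value G (f(i := f i \<otimes> x)) v \<otimes> inv (word_value G f v) \<in> H"
    if f: "f \<in> UNIV \<rightarrow> carrier G" for f i and v :: "nat gword"
  proof -
    let ?f = "f(i := f i \<otimes> x)"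
    have fc: "f j \<in> carrier G" for j using f by auto
    have f': "?f j \<in> carrier G" for j using fc x by simp
    have "(\<lambda>j. H #> ?f j) = (\<lambda>j. H #> f j)(i := (H #> f i) \<otimes>\<^bsub>G Mod H\<^esub> (H #> x))"
      by (rule ext) (use fc x in \<open>simp del: mult_FactGroup\<close>)
    then have "word_value (G Mod H) ((\<lambda>j. H #> f j)(i := (H #> f i) \<otimes>\<^bsub>G Mod H\<^esub> (H #> x))) v
        = H #> word_value G ?f v"
      using q.word_value_hom[of v ?f] f' by simp
    moreover have "word_value (G Mod H) (\<lambda>j. H #> f j) v = H #> word_value G f v"
      using q.word_value_hom[of v f] fc by simp
    moreover have "word_value G ?f v \<in> carrier G" "word_value G f v \<in> carrier G"
      using fc f' by (auto intro!: word_value_UNIV_closed)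
    ultimately show ?thesis using eq_iff by simp
  qed
  show ?thesis
  proof
    assume l: ?l
    show ?r
    proof (intro ballI allI)
      fix v i and f :: "nat \<Rightarrow> 'a" assume v: "v \<in> V" and f: "f \<in> UNIV \<rightarrow> carrier G"
      then have "(\<lambda>j. H #> f j) \<in> UNIV \<rightarrow> carrier (G Mod H)"
        by (auto simp: carrier_FactGroup)
      then show "word_value G (f(i := f i \<otimes> x)) v \<otimes> inv (word_value G f v) \<in> H"
        using key[OF f] marginal_word_value[OF l v, of "\<lambda>j. H #> f j" i] by simp
    qed
  next
    assume r: ?r
    show ?l
    proof (rule marginalI)
      show "H #> x \<in> carrier (G Mod H)" using x by (simp add: carrier_FactGroup)
      fix v i and g :: "nat \<Rightarrow> 'a set"
      assume v: "v \<in> V" and g: "g \<in> UNIV \<rightarrow> carrier (G Mod H)"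
      have "\<forall>j. \<exists>y\<in>carrier G. g j = H #> y"
        using g by (auto simp: carrier_FactGroup)
      then obtain f where f: "\<And>j. f j \<in> carrier G" "\<And>j. g j = H #> f j" by metis
      then have f': "f \<in> UNIV \<rightarrow> carrier G" and g': "g = (\<lambda>j. H #> f j)" by auto
      show "word_value (G Mod H) (g(i := g i \<otimes>\<^bsub>G Mod H\<^esub> (H #> x))) v
          = word_value (G Mod H) g v"
        unfolding g' using key[OF f'] r v f' by simp
    qed
  qed
qed

text \<open>The image under \<open>h\<close> lies in the marginal commutator subgroup formed from
  the trivial subgroup of \<open>H\<close>, and one is marginal.\<close>

lemma (in group_hom) marginal_commutator_kernel:
  "marginal_commutator V G (kernel G H h) \<subseteq> kernel G H h"
proof -
  have "h ` marginal_commutator V G (kernel G H h) \<subseteq> marginal_commutator V H {\<one>\<^bsub>H\<^esub>}"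
    by (rule hom_marginal_commutator) (auto simp: kernel_def)
  also have "\<dots> \<subseteq> {\<one>\<^bsub>H\<^esub>}"
    by (rule H.marginal_commutator_marginal) (simp add: H.one_marginal)
  finally have "h ` marginal_commutator V G (kernel G H h) \<subseteq> {\<one>\<^bsub>H\<^esub>}" .
  moreover have "marginal_commutator V G (kernel G H h) \<subseteq> carrier G"
    using normal_imp_subgroup[OF G.marginal_commutator_normal[OF normal_kernel]]
    by (rule subgroup.subset)
  ultimately show ?thesis unfolding kernel_def by blast
qed

text \<open>\<open>\<pi>\<close> factors through \<open>F Mod N\<close> because \<open>N\<close>
  lies in the kernel of \<open>\<pi>\<close>. The generators of \<open>N\<close> are the very
  quotients of word values that must lie in \<open>N\<close> for a kernel element to be marginal
  modulo \<open>N\<close>.\<close>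

lemma marginal_extension_Mod:
  assumes F: "group F" and G: "group G" and \<pi>: "\<pi> \<in> epi F G"
    and N: "N = marginal_commutator V F (kernel F G \<pi>)"
  obtains \<psi> where "marginal_extension V (F Mod N) \<psi> G"
    "\<And>x. x \<in> carrier F \<Longrightarrow> \<psi> (N #>\<^bsub>F\<^esub> x) = \<pi> x"
proof -
  interpret group_hom F G \<pi> using F G \<pi> by (rule group_hom_epi)
  let ?R = "kernel F G \<pi>"
  have Rc: "?R \<subseteq> carrier F" by (auto simp: kernel_def)
  have nN: "N \<lhd> F" unfolding N by (rule G.marginal_commutator_normal[OF normal_kernel])
  interpret N: normal N F by (rule nN)
  have "N \<subseteq> ?R" unfolding N by (rule marginal_commutator_kernel)
  then obtain \<psi> where \<psi>: "\<psi> \<in> hom (F Mod N) G"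
    "\<And>x. x \<in> carrier F \<Longrightarrow> \<psi> (N #>\<^bsub>F\<^esub> x) = \<pi> x"
    using FactGroup_universal_kernel[OF nN] by blast
  have "\<psi> \<in> epi (F Mod N) G"
    using \<psi> \<pi> by (auto simp: epi_def carrier_FactGroup image_comp)
  moreover have "kernel (F Mod N) G \<psi> \<subseteq> marginal V (F Mod N)"
  proof
    fix C assume "C \<in> kernel (F Mod N) G \<psi>"
    then obtain r where r: "r \<in> carrier F" "C = N #>\<^bsub>F\<^esub> r" "\<psi> C = \<one>\<^bsub>G\<^esub>"
      by (auto simp: kernel_def carrier_FactGroup)
    then have "r \<in> ?R" using \<psi>(2)[OF r(1)] by (simp add: kernel_def)
    then have "\<forall>v\<in>V. \<forall>f \<in> UNIV \<rightarrow> carrier F. \<forall>i.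
      word_value F (f(i := f i \<otimes>\<^bsub>F\<^esub> r)) v \<otimes>\<^bsub>F\<^esub> inv\<^bsub>F\<^esub> (word_value F f v) \<in> N"
      unfolding N marginal_commutator_def by (blast intro: generate.incl)
    then show "C \<in> marginal V (F Mod N)"
      unfolding r(2) using N.marginal_Mod_iff[OF r(1)] by blast
  qed
  ultimately have "marginal_extension V (F Mod N) \<psi> G"
    by (simp add: marginal_extension_def N.factorgroup_is_group)
  then show ?thesis using \<psi>(2) that by blast
qed

text \<open>Among all marginal extensions of \<open>G\<close>, the quotient \<open>F Mod N\<close>
  has the smallest image of its marginal subgroup. A lift \<open>\<theta>\<close> of
  \<open>\<pi>\<close> to \<open>E\<close> kills \<open>N\<close> and takes elements marginal modulo
  \<open>N\<close> to marginal elements of \<open>E\<close>.\<close>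

lemma free_presentation_marginal_image:
  assumes pres: "free_presentation F \<pi> G" and G: "group G"
    and N: "N = marginal_commutator V F (kernel F G \<pi>)"
    and y: "y \<in> carrier F" "N #>\<^bsub>F\<^esub> y \<in> marginal V (F Mod N)"
    and ext: "marginal_extension V E \<psi> G"
  shows "\<pi> y \<in> \<psi> ` marginal V E"
proof -
  have F: "group F" and \<pi>: "\<pi> \<in> epi F G" using pres by (auto simp: free_presentation_def)
  have E: "group E" and \<psi>: "\<psi> \<in> epi E G" and ker: "kernel E G \<psi> \<subseteq> marginal V E"
    using ext by (auto simp: marginal_extension_def)
  obtain \<theta> where \<theta>: "\<theta> \<in> hom F E" "\<And>x. x \<in> carrier F \<Longrightarrow> \<psi> (\<theta> x) = \<pi> x"
    using free_presentation_lift[OF pres G E \<psi>] by blast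
  interpret p: group_hom F G \<pi> using F G \<pi> by (rule group_hom_epi)
  interpret e: group_hom E G \<psi> using E G \<psi> by (rule group_hom_epi)
  interpret t: group_hom F E \<theta>
    using F E \<theta>(1) by (simp add: group_hom_def group_hom_axioms_def)
  have nN: "N \<lhd> F" unfolding N by (rule p.G.marginal_commutator_normal[OF p.normal_kernel])
  interpret N: normal N F by (rule nN)
  have R: "kernel F G \<pi> \<subseteq> carrier F" "kernel E G \<psi> \<subseteq> carrier E" by (auto simp: kernel_def)
  \<comment> \<open>\<open>\<theta>\<close> maps the kernel of \<open>\<pi>\<close> into that of
    \<open>\<psi>\<close>, which is marginal, so the corresponding marginal commutator subgroup of
    \<open>E\<close> is trivial.\<close>
  have "\<theta> ` N \<subseteq> marginal_commutator V E (kernel E G \<psi>)"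
    unfolding N by (rule t.hom_marginal_commutator[OF R]) (use \<theta> in \<open>auto simp: kernel_def\<close>)
  also have "\<dots> \<subseteq> {\<one>\<^bsub>E\<^esub>}" by (rule e.G.marginal_commutator_marginal[OF ker])
  finally have \<theta>N: "\<And>c. c \<in> N \<Longrightarrow> \<theta> c = \<one>\<^bsub>E\<^esub>" by blast
  have ty: "\<theta> y \<in> carrier E" using y(1) by simp
  have "\<theta> y \<in> marginal V E"
  proof (rule marginalI[OF ty])
    fix v i and g :: "nat \<Rightarrow> _" assume v: "v \<in> V" and "g \<in> UNIV \<rightarrow> carrier E"
    then have g: "g j \<in> carrier E" for j by auto
    have "\<forall>j. \<exists>x\<in>carrier F. \<pi> x = \<psi> (g j)"
      using \<pi> e.hom_closed[OF g] unfolding epi_def by (metis (mono_tags, lifting) imageE mem_Collect_eq)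
    then obtain f where f: "\<And>j. f j \<in> carrier F" "\<And>j. \<pi> (f j) = \<psi> (g j)" by metis
    \<comment> \<open>\<open>\<theta>\<close> need not be onto, but \<open>E\<close> is the product of its image and the kernel of \<open>\<psi>\<close>.\<close>
    define k where "k j = inv\<^bsub>E\<^esub> (\<theta> (f j)) \<otimes>\<^bsub>E\<^esub> g j" for j
    have kc: "k j \<in> carrier E" for j using f g by (simp add: k_def)
    have "\<psi> (k j) = \<one>\<^bsub>G\<^esub>" for j using f g \<theta>(2) by (simp add: k_def)
    then have k: "k j \<in> marginal V E" for j using ker kc by (auto simp: kernel_def)
    have gk: "g = (\<lambda>j. \<theta> (f j) \<otimes>\<^bsub>E\<^esub> k j)"
      using f g by (auto simp: k_def simp flip: e.G.m_assoc)
    let ?f = "f(i := f i \<otimes>\<^bsub>F\<^esub> y)"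
    \<comment> \<open>Moving \<open>\<theta> y\<close> to the left past \<open>k i\<close> replaces
      \<open>k i\<close> by a conjugate, still marginal by normality. So the changed tuple is again
      an image under \<open>\<theta>\<close> times marginal factors.\<close>
    define l where "l = k(i := inv\<^bsub>E\<^esub> (\<theta> y) \<otimes>\<^bsub>E\<^esub> k i \<otimes>\<^bsub>E\<^esub> \<theta> y)"
    have "inv\<^bsub>E\<^esub> (\<theta> y) \<otimes>\<^bsub>E\<^esub> k i \<otimes>\<^bsub>E\<^esub> \<theta> y \<in> marginal V E"
      by (rule normal.inv_op_closed1[OF e.G.marginal_normal ty k])
    then have l: "l j \<in> marginal V E" for j using k by (simp add: l_def)
    have f': "?f j \<in> carrier F" for j using f(1) y(1) by simp
    have t1: "\<theta> y \<otimes>\<^bsub>E\<^esub> (inv\<^bsub>E\<^esub> (\<theta> y) \<otimes>\<^bsub>E\<^esub> x) = x" if "x \<in> carrier E" for x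
      using that ty by (simp flip: e.G.m_assoc)
    have gl: "g(i := g i \<otimes>\<^bsub>E\<^esub> \<theta> y) = (\<lambda>j. \<theta> (?f j) \<otimes>\<^bsub>E\<^esub> l j)"
      unfolding gk using f(1) kc ty y(1) by (auto simp: l_def e.G.m_assoc t1)
    have wc: "word_value F f v \<in> carrier F" "word_value F ?f v \<in> carrier F"
      using f(1) f' by (auto intro!: p.G.word_value_UNIV_closed)
    have "word_value F ?f v \<otimes>\<^bsub>F\<^esub> inv\<^bsub>F\<^esub> (word_value F f v) \<in> N"
      using N.marginal_Mod_iff[OF y(1), of V] y(2) v f(1) by blast
    then have "\<theta> (word_value F ?f v) \<otimes>\<^bsub>E\<^esub> inv\<^bsub>E\<^esub> \<theta> (word_value F f v) = \<one>\<^bsub>E\<^esub>"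
      using \<theta>N wc by fastforce
    then have *: "\<theta> (word_value F ?f v) = \<theta> (word_value F f v)"
      using wc e.G.inv_solve_right[of "\<one>\<^bsub>E\<^esub>" "\<theta> (word_value F ?f v)" "\<theta> (word_value F f v)"]
      by simp
    have "word_value E (g(i := g i \<otimes>\<^bsub>E\<^esub> \<theta> y)) v = word_value E (\<lambda>j. \<theta> (?f j)) v"
      unfolding gl by (rule e.G.word_value_mult_marginal[OF _ l v]) (use t.hom_closed[OF f'] in blast)
    also have "\<dots> = word_value E (\<lambda>j. \<theta> (f j)) v"
      using * t.word_value_hom[of v ?f] t.word_value_hom[of v f] f(1) f' by simp
    also have "\<dots> = word_value E g v"
      unfolding gk by (rule e.G.word_value_mult_marginal[OF _ k v, symmetric])
        (use t.hom_closed[OF f(1)] in blast)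
    finally show "word_value E (g(i := g i \<otimes>\<^bsub>E\<^esub> \<theta> y)) v = word_value E g v" .
  qed
  then show ?thesis using \<theta>(2)[OF y(1)] by (metis image_eqI)
qed

section \<open>Capability\<close>

lemma one_in_epimarginal:
  fixes U :: "'e itself"
  assumes "group G"
  shows "\<one>\<^bsub>G\<^esub> \<in> epimarginal U V G"
  unfolding epimarginal_def
proof clarify
  fix E :: "'e monoid" and \<psi> assume "group E" "\<psi> \<in> epi E G"
  then interpret group_hom E G \<psi> using assms by (intro group_hom_epi)
  show "\<one>\<^bsub>G\<^esub> \<in> \<psi> ` marginal V E"
    using G.one_marginal hom_one by (metis image_eqI)
qed

text \<open>Capability means that some marginal extension has the whole marginal subgroup as its
  kernel. Since \<open>F Mod N\<close> attains the intersection \<open>epimarginal\<close>, a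
  trivial intersection is already attained by a single extension, which can be shrunk to
  \<open>'e\<close>.\<close>

lemma capable_iff_epimarginal_trivial:
  assumes inf: "infinite (UNIV :: 'e set)" and le: "carrier G \<lesssim> (UNIV :: 'e set)"
    and pres: "free_presentation F \<pi> G" and G: "group G"
  shows "capable TYPE('e) V G \<longleftrightarrow> epimarginal TYPE('e) V G = {\<one>\<^bsub>G\<^esub>}"
proof
  assume "capable TYPE('e) V G"
  then obtain E :: "'e monoid" where E: "group E" and iso: "G \<cong> E Mod marginal V E"
    by (auto simp: capable_def)
  interpret E: group E by fact
  interpret M: normal "marginal V E" E by (rule E.marginal_normal)
  obtain k where k: "k \<in> iso (E Mod marginal V E) G"
    using group.iso_sym[OF G iso] by (auto simp: is_iso_def)
  interpret k: group_hom "E Mod marginal V E" G k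
    using k G M.factorgroup_is_group by (simp add: group_hom_def group_hom_axioms_def iso_def)
  let ?q = "\<lambda>a. marginal V E #>\<^bsub>E\<^esub> a"
  have "k \<circ> ?q \<in> epi E G"
  proof (rule epi_compose)
    show "?q \<in> epi E (E Mod marginal V E)"
      using M.r_coset_hom_Mod by (simp add: epi_def carrier_FactGroup)
  qed (use k in \<open>simp add: iso_iff_mon_epi\<close>)
  moreover have inj: "k (?q a) = \<one>\<^bsub>G\<^esub> \<longleftrightarrow> a \<in> marginal V E" if "a \<in> carrier E" for a
  proof -
    have "?q a \<in> carrier (E Mod marginal V E)" using that by (auto simp: carrier_FactGroup)
    moreover have "inj_on k (carrier (E Mod marginal V E))"
      using k by (simp add: iso_def bij_betw_def)
    ultimately have "k (?q a) = \<one>\<^bsub>G\<^esub> \<longleftrightarrow> ?q a = \<one>\<^bsub>E Mod marginal V E\<^esub>"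
      using k.hom_one k.G.one_closed by (metis inj_onD)
    also have "\<dots> \<longleftrightarrow> a \<in> marginal V E"
      using that E.coset_join1[OF _ that M.subgroup_axioms]
        E.coset_join2[OF that M.subgroup_axioms] by auto
    finally show ?thesis .
  qed
  ultimately have "marginal_extension V E (k \<circ> ?q) G"
    using E by (auto simp: marginal_extension_def kernel_def)
  moreover have "(k \<circ> ?q) ` marginal V E \<subseteq> {\<one>\<^bsub>G\<^esub>}"
    using inj marginal_carrier by fastforce
  ultimately have "epimarginal TYPE('e) V G \<subseteq> {\<one>\<^bsub>G\<^esub>}"
    unfolding epimarginal_mem_iff subset_iff by blast
  then show "epimarginal TYPE('e) V G = {\<one>\<^bsub>G\<^esub>}"
    using one_in_epimarginal[OF G] by blast
next
  assume triv: "epimarginal TYPE('e) V G = {\<one>\<^bsub>G\<^esub>}"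
  have F: "group F" and \<pi>: "\<pi> \<in> epi F G" using pres by (auto simp: free_presentation_def)
  define N where "N = marginal_commutator V F (kernel F G \<pi>)"
  obtain \<psi> where ext: "marginal_extension V (F Mod N) \<psi> G"
    and \<psi>: "\<And>x. x \<in> carrier F \<Longrightarrow> \<psi> (N #>\<^bsub>F\<^esub> x) = \<pi> x"
    using marginal_extension_Mod[OF F G \<pi> N_def] by blast
  \<comment> \<open>By minimality of \<open>F Mod N\<close>, the image of its marginal subgroup lies
    in every set of the intersection, which is trivial by assumption.\<close>
  have "\<psi> ` marginal V (F Mod N) \<subseteq> {\<one>\<^bsub>G\<^esub>}"
  proof clarify
    fix C assume C: "C \<in> marginal V (F Mod N)"
    then obtain x where x: "x \<in> carrier F" "C = N #>\<^bsub>F\<^esub> x"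
      using marginal_carrier by (fastforce simp: carrier_FactGroup)
    have "\<pi> x \<in> epimarginal TYPE('e) V G"
      unfolding epimarginal_mem_iff
      using free_presentation_marginal_image[OF pres G N_def x(1)] C x(2) by blast
    then show "\<psi> C = \<one>\<^bsub>G\<^esub>" using triv \<psi>[OF x(1)] x(2) by simp
  qed
  then obtain E :: "'e monoid" and \<phi> where E: "marginal_extension V E \<phi> G"
    and triv': "\<phi> ` marginal V E \<subseteq> {\<one>\<^bsub>G\<^esub>}"
    using marginal_extension_shrink[OF inf le G ext] by (metis subset_trans)
  interpret group_hom E G \<phi>
    using E G by (auto simp: marginal_extension_def intro: group_hom_epi)
  \<comment> \<open>One inclusion is part of being a marginal extension, the other says that
    \<open>\<phi>\<close> kills the marginal subgroup.\<close>
  have "kernel E G \<phi> = marginal V E"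
    using E triv' marginal_carrier by (fastforce simp: marginal_extension_def kernel_def)
  moreover have "\<phi> ` carrier E = carrier G" using E by (simp add: marginal_extension_def epi_def)
  ultimately have "E Mod marginal V E \<cong> G"
    using FactGroup_iso_set by (auto simp: is_iso_def)
  then have "G \<cong> E Mod marginal V E"
    using group.iso_sym normal.factorgroup_is_group[OF G.marginal_normal] by blast
  then show "capable TYPE('e) V G" using G.is_group unfolding capable_def by blast
qed

section \<open>Direct products\<close>

lemma marginal_extension_id: "group G \<Longrightarrow> marginal_extension V G id G"
  using group.one_marginal[of G V]
  by (auto simp add: marginal_extension_def epi_def hom_def kernel_def)

text \<open>An empty intersection would be the whole type. The identity extension of
  \<open>G\<close>, shrunk to a group on \<open>'e\<close>, supplies a member of the family.\<close>

lemma epimarginal_subset_carrier: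
  assumes "infinite (UNIV :: 'e set)" "carrier G \<lesssim> (UNIV :: 'e set)" "group G"
  shows "epimarginal TYPE('e) V G \<subseteq> carrier G"
proof
  fix a assume a: "a \<in> epimarginal TYPE('e) V G"
  obtain E :: "'e monoid" and \<phi>
    where "marginal_extension V E \<phi> G" "\<phi> ` marginal V E \<subseteq> id ` marginal V G"
    using marginal_extension_shrink[OF assms marginal_extension_id[OF assms(3)]] by blast
  then have "a \<in> marginal V G" using a unfolding epimarginal_mem_iff by auto
  then show "a \<in> carrier G" by (rule marginal_carrier)
qed

section \<open>Projections and products of marginal extensions\<close>

lemma fst_epi_DirProd:
  assumes "group B"
  shows "fst \<in> epi (A \<times>\<times> B) A"
proof -
  have "carrier B \<noteq> {}" using group.is_monoid[OF assms] monoid.one_closed by blast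
  then show ?thesis by (auto simp: epi_def hom_def)
qed

lemma snd_epi_DirProd:
  assumes "group A"
  shows "snd \<in> epi (A \<times>\<times> B) B"
proof -
  have "carrier A \<noteq> {}" using group.is_monoid[OF assms] monoid.one_closed by blast
  then show ?thesis by (auto simp: epi_def hom_def)
qed

lemma marginal_DirProd:
  assumes A: "group A" and B: "group B" and a: "a \<in> marginal V A" and b: "b \<in> marginal V B"
  shows "(a, b) \<in> marginal V (A \<times>\<times> B)"
proof (rule marginalI)
  have AB: "group (A \<times>\<times> B)" by (rule DirProd_group[OF A B])
  interpret f: group_hom "A \<times>\<times> B" A fst by (rule group_hom_epi[OF AB A fst_epi_DirProd[OF B]])
  interpret s: group_hom "A \<times>\<times> B" B snd by (rule group_hom_epi[OF AB B snd_epi_DirProd[OF A]])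
  note ac = marginal_carrier[OF a] and bc = marginal_carrier[OF b]
  show ab: "(a, b) \<in> carrier (A \<times>\<times> B)" using ac bc by simp
  fix v i and g :: "nat \<Rightarrow> _" assume v: "v \<in> V" and "g \<in> UNIV \<rightarrow> carrier (A \<times>\<times> B)"
  then have g: "g j \<in> carrier (A \<times>\<times> B)" for j by blast
  let ?g = "g(i := g i \<otimes>\<^bsub>A \<times>\<times> B\<^esub> (a, b))"
  have g': "?g j \<in> carrier (A \<times>\<times> B)" for j
    using g f.G.m_closed[OF g ab] by simp
  have gc: "fst (g j) \<in> carrier A" "snd (g j) \<in> carrier B" for j using g[of j] by auto
  have "(\<lambda>j. fst (?g j)) = (\<lambda>j. fst (g j))(i := fst (g i) \<otimes>\<^bsub>A\<^esub> a)"
    by (auto simp: mult_DirProd')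
  then have "fst (word_value (A \<times>\<times> B) ?g v) = fst (word_value (A \<times>\<times> B) g v)"
    using marginal_word_value[OF a v, of "\<lambda>j. fst (g j)" i]
      f.word_value_hom[of v ?g, OF g'] f.word_value_hom[of v g, OF g] gc by simp
  moreover have "(\<lambda>j. snd (?g j)) = (\<lambda>j. snd (g j))(i := snd (g i) \<otimes>\<^bsub>B\<^esub> b)"
    by (auto simp: mult_DirProd')
  then have "snd (word_value (A \<times>\<times> B) ?g v) = snd (word_value (A \<times>\<times> B) g v)"
    using marginal_word_value[OF b v, of "\<lambda>j. snd (g j)" i]
      s.word_value_hom[of v ?g, OF g'] s.word_value_hom[of v g, OF g] gc by simp
  ultimately show "word_value (A \<times>\<times> B) ?g v = word_value (A \<times>\<times> B) g v"
    by (rule prod_eqI)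
qed

lemma marginal_extension_DirProd:
  assumes A: "group A" and B: "group B"
    and ext: "marginal_extension V E \<psi> A" "marginal_extension V D \<phi> B"
  shows "marginal_extension V (E \<times>\<times> D) (map_prod \<psi> \<phi>) (A \<times>\<times> B)"
proof -
  have E: "group E" "\<psi> \<in> epi E A" "kernel E A \<psi> \<subseteq> marginal V E"
    and D: "group D" "\<phi> \<in> epi D B" "kernel D B \<phi> \<subseteq> marginal V D"
    using ext by (auto simp: marginal_extension_def)
  have "map_prod \<psi> \<phi> \<in> epi (E \<times>\<times> D) (A \<times>\<times> B)"
    using E D by (auto simp: epi_def hom_def map_prod_surj_on)
  moreover have "kernel (E \<times>\<times> D) (A \<times>\<times> B) (map_prod \<psi> \<phi>) \<subseteq> marginal V (E \<times>\<times> D)"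
    using E D by (auto simp: kernel_def intro!: marginal_DirProd)
  ultimately show ?thesis
    using DirProd_group E(1) D(1) by (auto simp: marginal_extension_def)
qed

text \<open>An extension \<open>E\<close> of one factor, multiplied by the identity on the other,
  extends the product. A preimage of \<open>(a, b)\<close> there is marginal, and projecting onto
  \<open>E\<close> preserves marginality.\<close>

lemma epimarginal_DirProd_subset:
  assumes inf: "infinite (UNIV :: 'e set)" and le: "carrier (A \<times>\<times> B) \<lesssim> (UNIV :: 'e set)"
    and A: "group A" and B: "group B"
  shows "epimarginal TYPE('e) V (A \<times>\<times> B) \<subseteq> epimarginal TYPE('e) V A \<times> epimarginal TYPE('e) V B"
proof clarify
  fix a b assume ab: "(a, b) \<in> epimarginal TYPE('e) V (A \<times>\<times> B)"
  have AB: "group (A \<times>\<times> B)" by (rule DirProd_group[OF A B])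
  have "(a, b) \<in> carrier (A \<times>\<times> B)"
    using epimarginal_subset_carrier[OF inf le AB] ab by blast
  then have a: "a \<in> carrier A" and b: "b \<in> carrier B" by auto
  have "a \<in> \<psi> ` marginal V E" if ext: "marginal_extension V E \<psi> A" for E :: "'e monoid" and \<psi>
  proof -
    have E: "group E" and \<psi>: "\<psi> \<in> epi E A" using ext by (auto simp: marginal_extension_def)
    obtain e where e: "e \<in> carrier E" "\<psi> e = a" using a \<psi> by (force simp: epi_def)
    \<comment> \<open>The elements of this product do not have type \<open>'e\<close>, so
      \<open>epimarginal_preimage\<close> replaces the definition of
      \<open>epimarginal\<close>.\<close>
    have "(e, b) \<in> marginal V (E \<times>\<times> B)"
      by (rule epimarginal_preimage[OF inf le AB
            marginal_extension_DirProd[OF A B ext marginal_extension_id[OF B]]])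
        (use e b ab in auto)
    then have "e \<in> marginal V E"
      using marginal_epi[OF DirProd_group[OF E B] E fst_epi_DirProd[OF B], of V] by force
    then show ?thesis using e(2) by blast
  qed
  moreover have "b \<in> \<psi> ` marginal V E" if ext: "marginal_extension V E \<psi> B"
    for E :: "'e monoid" and \<psi>
  proof -
    have E: "group E" and \<psi>: "\<psi> \<in> epi E B" using ext by (auto simp: marginal_extension_def)
    obtain e where e: "e \<in> carrier E" "\<psi> e = b" using b \<psi> by (force simp: epi_def)
    have "(a, e) \<in> marginal V (A \<times>\<times> E)"
      by (rule epimarginal_preimage[OF inf le AB
            marginal_extension_DirProd[OF A B marginal_extension_id[OF A] ext]])
        (use e a ab in auto)
    then have "e \<in> marginal V E"
      using marginal_epi[OF DirProd_group[OF A E] E snd_epi_DirProd[OF A], of V] by force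
    then show ?thesis using e(2) by blast
  qed
  ultimately show "a \<in> epimarginal TYPE('e) V A \<and> b \<in> epimarginal TYPE('e) V B"
    unfolding epimarginal_mem_iff by blast
qed

text \<open>\<open>\<alpha> y\<close> lies over an element of \<open>epimarginal\<close>, so it is
  marginal modulo the marginal commutator subgroup of \<open>F'\<close>. Testing this at the tuple
  of all \<open>\<alpha> (f j)\<close> gives the image of the word quotient.\<close>

lemma lift_word_value_mem:
  assumes inf: "infinite (UNIV :: 'e set)" and le: "carrier A \<lesssim> (UNIV :: 'e set)"
    and F: "group F" and A: "group A"
    and pres: "free_presentation F' \<pi>' A" and lift: "is_lift F \<pi> F' \<pi>' p \<alpha>"
    and y: "y \<in> carrier F" "p (\<pi> y) \<in> epimarginal TYPE('e) V A"
    and v: "v \<in> V" and f: "f \<in> UNIV \<rightarrow> carrier F"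
  shows "\<alpha> (word_value F (f(i := f i \<otimes>\<^bsub>F\<^esub> y)) v \<otimes>\<^bsub>F\<^esub> inv\<^bsub>F\<^esub> (word_value F f v))
    \<in> marginal_commutator V F' (kernel F' A \<pi>')"
proof -
  have F': "group F'" and \<pi>': "\<pi>' \<in> epi F' A" using pres by (auto simp: free_presentation_def)
  have \<alpha>: "\<alpha> \<in> hom F F'" "\<pi>' (\<alpha> y) = p (\<pi> y)" using lift y by (auto simp: is_lift_def)
  interpret h: group_hom F F' \<alpha>
    using F F' \<alpha> by (simp add: group_hom_def group_hom_axioms_def)
  interpret p: group_hom F' A \<pi>' by (rule group_hom_epi[OF F' A \<pi>'])
  define N where "N = marginal_commutator V F' (kernel F' A \<pi>')"
  interpret N: normal N F'
    unfolding N_def by (rule h.H.marginal_commutator_normal[OF p.normal_kernel])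
  have ay: "\<alpha> y \<in> carrier F'" using y(1) by simp
  obtain \<psi> where ext: "marginal_extension V (F' Mod N) \<psi> A"
    and \<psi>: "\<And>x. x \<in> carrier F' \<Longrightarrow> \<psi> (N #>\<^bsub>F'\<^esub> x) = \<pi>' x"
    using marginal_extension_Mod[OF F' A \<pi>' N_def] by blast
  have "N #>\<^bsub>F'\<^esub> \<alpha> y \<in> marginal V (F' Mod N)"
    by (rule epimarginal_preimage[OF inf le A ext])
      (use ay \<psi>[OF ay] \<alpha>(2) y(2) in \<open>auto simp: carrier_FactGroup\<close>)
  moreover have "(\<lambda>j. \<alpha> (f j)) \<in> UNIV \<rightarrow> carrier F'" using f by (simp add: Pi_iff)
  ultimately have "word_value F' ((\<lambda>j. \<alpha> (f j))(i := \<alpha> (f i) \<otimes>\<^bsub>F'\<^esub> \<alpha> y)) v \<otimes>\<^bsub>F'\<^esub>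
      inv\<^bsub>F'\<^esub> (word_value F' (\<lambda>j. \<alpha> (f j)) v) \<in> N"
    using N.marginal_Mod_iff[OF ay, of V] v by blast
  moreover
  let ?f = "f(i := f i \<otimes>\<^bsub>F\<^esub> y)"
  have fc: "f j \<in> carrier F" for j using f by auto
  have f': "?f j \<in> carrier F" for j using fc y(1) by simp
  have "(\<lambda>j. \<alpha> (?f j)) = (\<lambda>j. \<alpha> (f j))(i := \<alpha> (f i) \<otimes>\<^bsub>F'\<^esub> \<alpha> y)" using fc y(1) by auto
  moreover have "word_value F f v \<in> carrier F" "word_value F ?f v \<in> carrier F"
    using fc f' by (auto intro!: h.G.word_value_UNIV_closed)
  ultimately show ?thesis
    using h.word_value_hom[of v ?f] h.word_value_hom[of v f] fc f' by (simp add: N_def)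
qed

text \<open>\<open>\<alpha>\<close> maps the whole coset of \<open>c\<close> into the target
  subgroup, and a subgroup times a non-empty subset of itself is the subgroup. Hence the class of
  \<open>c\<close> has trivial image.\<close>

lemma baer_map_trivial:
  assumes F: "group F" and F': "group F'" and \<alpha>: "\<alpha> \<in> hom F F'"
    and A: "group A" and \<pi>': "\<pi>' \<in> epi F' A"
    and R: "R \<subseteq> carrier F" "\<alpha> ` R \<subseteq> kernel F' A \<pi>'" and c: "c \<in> carrier F"
    and ac: "\<alpha> c \<in> marginal_commutator V F' (kernel F' A \<pi>')"
  shows "baer_map V F' \<pi>' A \<alpha> (marginal_commutator V F R #>\<^bsub>F\<^esub> c) =
    marginal_commutator V F' (kernel F' A \<pi>')"
proof -
  interpret h: group_hom F F' \<alpha>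
    using F F' \<alpha> by (simp add: group_hom_def group_hom_axioms_def)
  interpret p: group_hom F' A \<pi>' by (rule group_hom_epi[OF F' A \<pi>'])
  define N where "N = marginal_commutator V F' (kernel F' A \<pi>')"
  interpret N: normal N F'
    unfolding N_def by (rule h.H.marginal_commutator_normal[OF p.normal_kernel])
  let ?M = "marginal_commutator V F R"
  have M: "subgroup ?M F"
    unfolding marginal_commutator_def
    by (rule h.G.generate_is_subgroup[OF h.G.marginal_commutator_gens[OF R(1)]])
  have "\<alpha> ` ?M \<subseteq> N"
    unfolding N_def by (rule h.hom_marginal_commutator[OF R(1) _ R(2)]) (auto simp: kernel_def)
  then have sub: "\<alpha> ` (?M #>\<^bsub>F\<^esub> c) \<subseteq> N"
    using ac c subgroup.mem_carrier[OF M] by (auto simp: r_coset_def N_def[symmetric])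
  have ne: "\<alpha> c \<in> \<alpha> ` (?M #>\<^bsub>F\<^esub> c)"
    using h.G.rcos_self[OF c M] by blast
  have "N <#>\<^bsub>F'\<^esub> (\<alpha> ` (?M #>\<^bsub>F\<^esub> c)) = N"
  proof
    show "N <#>\<^bsub>F'\<^esub> (\<alpha> ` (?M #>\<^bsub>F\<^esub> c)) \<subseteq> N" using sub by (auto simp: set_mult_def)
    show "N \<subseteq> N <#>\<^bsub>F'\<^esub> (\<alpha> ` (?M #>\<^bsub>F\<^esub> c))"
    proof
      fix n assume n: "n \<in> N"
      have ac': "\<alpha> c \<in> N" using ac by (simp add: N_def)
      have "n = (n \<otimes>\<^bsub>F'\<^esub> inv\<^bsub>F'\<^esub> (\<alpha> c)) \<otimes>\<^bsub>F'\<^esub> \<alpha> c"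
        using N.mem_carrier[OF n] c by (simp add: h.H.m_assoc)
      moreover have "n \<otimes>\<^bsub>F'\<^esub> inv\<^bsub>F'\<^esub> (\<alpha> c) \<in> N" using n ac' by simp
      ultimately show "n \<in> N <#>\<^bsub>F'\<^esub> (\<alpha> ` (?M #>\<^bsub>F\<^esub> c))"
        using ne unfolding set_mult_def by blast
    qed
  qed
  then show ?thesis by (simp add: baer_map_def N_def)
qed

theorem theorem3p1:
  fixes V :: "nat gword set"
    and A :: "'a monoid" and B :: "'b monoid"
    and F :: "'f monoid" and F\<^sub>A :: "'p monoid" and F\<^sub>B :: "'q monoid"
    and \<pi> :: "'f \<Rightarrow> 'a \<times> 'b" and \<pi>\<^sub>A :: "'p \<Rightarrow> 'a" and \<pi>\<^sub>B :: "'q \<Rightarrow> 'b"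
    and \<alpha> :: "'f \<Rightarrow> 'p" and \<beta> :: "'f \<Rightarrow> 'q"
  assumes "group A" and "group B"
    and "infinite (UNIV :: 'e set)"
    and "carrier A \<lesssim> (UNIV :: 'e set)" and "carrier B \<lesssim> (UNIV :: 'e set)"
    and "free_presentation F \<pi> (A \<times>\<times> B)"
    and "free_presentation F\<^sub>A \<pi>\<^sub>A A"
    and "free_presentation F\<^sub>B \<pi>\<^sub>B B"
    and "is_lift F \<pi> F\<^sub>A \<pi>\<^sub>A fst \<alpha>"
    and "is_lift F \<pi> F\<^sub>B \<pi>\<^sub>B snd \<beta>"
    and "(\<lambda>C. (baer_map V F\<^sub>A \<pi>\<^sub>A A \<alpha> C, baer_map V F\<^sub>B \<pi>\<^sub>B B \<beta> C))
           \<in> iso (baer_invariant V F \<pi> (A \<times>\<times> B))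
                 (baer_invariant V F\<^sub>A \<pi>\<^sub>A A \<times>\<times> baer_invariant V F\<^sub>B \<pi>\<^sub>B B)"
  shows "epimarginal TYPE('e) V (A \<times>\<times> B) = epimarginal TYPE('e) V A \<times> epimarginal TYPE('e) V B
       \<and> (capable TYPE('e) V (A \<times>\<times> B) \<longleftrightarrow> capable TYPE('e) V A \<and> capable TYPE('e) V B)"
proof -
  note A = assms(1) and B = assms(2) and inf = assms(3) and leA = assms(4) and leB = assms(5)
    and pres = assms(6) and presA = assms(7) and presB = assms(8)
    and liftA = assms(9) and liftB = assms(10)
  have AB: "group (A \<times>\<times> B)" by (rule DirProd_group[OF A B])
  have le: "carrier (A \<times>\<times> B) \<lesssim> (UNIV :: 'e set)"
    using infinite_times_lepoll[OF inf leA leB] by simp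
  have F: "group F" "\<pi> \<in> epi F (A \<times>\<times> B)" and FA: "group F\<^sub>A" "\<pi>\<^sub>A \<in> epi F\<^sub>A A"
    and FB: "group F\<^sub>B" "\<pi>\<^sub>B \<in> epi F\<^sub>B B"
    using pres presA presB by (auto simp: free_presentation_def)
  have \<alpha>: "\<alpha> \<in> hom F F\<^sub>A" "\<And>x. x \<in> carrier F \<Longrightarrow> \<pi>\<^sub>A (\<alpha> x) = fst (\<pi> x)"
    and \<beta>: "\<beta> \<in> hom F F\<^sub>B" "\<And>x. x \<in> carrier F \<Longrightarrow> \<pi>\<^sub>B (\<beta> x) = snd (\<pi> x)"
    using liftA liftB by (auto simp: is_lift_def)
  interpret p: group_hom F "A \<times>\<times> B" \<pi> by (rule group_hom_epi[OF F(1) AB F(2)])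
  interpret pA: group_hom F\<^sub>A A \<pi>\<^sub>A by (rule group_hom_epi[OF FA(1) A FA(2)])
  interpret pB: group_hom F\<^sub>B B \<pi>\<^sub>B by (rule group_hom_epi[OF FB(1) B FB(2)])
  let ?R = "kernel F (A \<times>\<times> B) \<pi>" and ?NA = "marginal_commutator V F\<^sub>A (kernel F\<^sub>A A \<pi>\<^sub>A)"
    and ?NB = "marginal_commutator V F\<^sub>B (kernel F\<^sub>B B \<pi>\<^sub>B)"
  define N where "N = marginal_commutator V F ?R"
  interpret N: normal N F
    unfolding N_def by (rule p.G.marginal_commutator_normal[OF p.normal_kernel])
  have R: "?R \<subseteq> carrier F" by (auto simp: kernel_def)
  have RA: "\<alpha> ` ?R \<subseteq> kernel F\<^sub>A A \<pi>\<^sub>A" and RB: "\<beta> ` ?R \<subseteq> kernel F\<^sub>B B \<pi>\<^sub>B"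
    using \<alpha> \<beta> by (auto simp: kernel_def hom_def)
  have vgen: "{word_value F g v | g v. v \<in> V \<and> g \<in> UNIV \<rightarrow> carrier F} \<subseteq> carrier F"
    by (auto intro: p.G.word_value_UNIV_closed)
  have verb: "subgroup (verbal V F) F"
    unfolding verbal_def by (rule p.G.generate_is_subgroup[OF vgen])
  \<comment> \<open>The hypothesis on the Baer invariants enters through injectivity: the cosets of
    \<open>c\<close> and of one both go to the pair of trivial classes, so they coincide.\<close>
  have inj: "c \<in> N" if c: "c \<in> ?R" "c \<in> verbal V F" and cA: "\<alpha> c \<in> ?NA" and cB: "\<beta> c \<in> ?NB" for c
  proof -
    have cc: "c \<in> carrier F" using c(1) R by blast
    have carr: "N #>\<^bsub>F\<^esub> x \<in> carrier (baer_invariant V F \<pi> (A \<times>\<times> B))"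
      if "x \<in> ?R" "x \<in> verbal V F" for x
      using that by (auto simp: baer_invariant_def carrier_FactGroup N_def r_coset_def)
    have "\<alpha> \<one>\<^bsub>F\<^esub> = \<one>\<^bsub>F\<^sub>A\<^esub>" "\<beta> \<one>\<^bsub>F\<^esub> = \<one>\<^bsub>F\<^sub>B\<^esub>"
      using hom_one \<alpha>(1) \<beta>(1) F FA FB by blast+
    then have one: "\<alpha> \<one>\<^bsub>F\<^esub> \<in> ?NA" "\<beta> \<one>\<^bsub>F\<^esub> \<in> ?NB"
      by (auto simp: marginal_commutator_def intro: generate.one)
    have 1: "\<one>\<^bsub>F\<^esub> \<in> ?R" "\<one>\<^bsub>F\<^esub> \<in> verbal V F"
      using subgroup.one_closed[OF p.subgroup_kernel] subgroup.one_closed[OF verb] by auto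
    have "(baer_map V F\<^sub>A \<pi>\<^sub>A A \<alpha> (N #>\<^bsub>F\<^esub> c), baer_map V F\<^sub>B \<pi>\<^sub>B B \<beta> (N #>\<^bsub>F\<^esub> c)) =
        (baer_map V F\<^sub>A \<pi>\<^sub>A A \<alpha> (N #>\<^bsub>F\<^esub> \<one>\<^bsub>F\<^esub>), baer_map V F\<^sub>B \<pi>\<^sub>B B \<beta> (N #>\<^bsub>F\<^esub> \<one>\<^bsub>F\<^esub>))"
      unfolding N_def
      by (simp add: baer_map_trivial[OF F(1) FA(1) \<alpha>(1) A FA(2) R RA]
          baer_map_trivial[OF F(1) FB(1) \<beta>(1) B FB(2) R RB] cc cA cB one)
    moreover have "inj_on (\<lambda>C. (baer_map V F\<^sub>A \<pi>\<^sub>A A \<alpha> C, baer_map V F\<^sub>B \<pi>\<^sub>B B \<beta> C))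
        (carrier (baer_invariant V F \<pi> (A \<times>\<times> B)))"
      using assms(11) by (simp add: iso_def bij_betw_def)
    ultimately have "N #>\<^bsub>F\<^esub> c = N #>\<^bsub>F\<^esub> \<one>\<^bsub>F\<^esub>"
      using carr[OF c] carr[OF 1] by (auto dest: inj_onD)
    then have "N #>\<^bsub>F\<^esub> c = N" by (simp add: p.G.coset_mult_one N.subset)
    then show ?thesis by (rule p.G.coset_join1[OF _ cc N.subgroup_axioms])
  qed
  have NA: "?NA \<subseteq> kernel F\<^sub>A A \<pi>\<^sub>A" and NB: "?NB \<subseteq> kernel F\<^sub>B B \<pi>\<^sub>B"
    by (rule pA.marginal_commutator_kernel, rule pB.marginal_commutator_kernel)
  have "epimarginal TYPE('e) V A \<times> epimarginal TYPE('e) V B \<subseteq> epimarginal TYPE('e) V (A \<times>\<times> B)"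
  proof clarify
    fix a b assume a: "a \<in> epimarginal TYPE('e) V A" and b: "b \<in> epimarginal TYPE('e) V B"
    have "(a, b) \<in> \<pi> ` carrier F"
      using F(2) subsetD[OF epimarginal_subset_carrier[OF inf leA A] a]
        subsetD[OF epimarginal_subset_carrier[OF inf leB B] b]
      by (simp add: epi_def)
    then obtain y where y: "y \<in> carrier F" "\<pi> y = (a, b)" by (metis imageE)
    \<comment> \<open>Once this is known, minimality of \<open>F Mod N\<close> puts
      \<open>(a, b) = \<pi> y\<close> into \<open>epimarginal\<close> of the product.\<close>
    have "N #>\<^bsub>F\<^esub> y \<in> marginal V (F Mod N)"
      unfolding N.marginal_Mod_iff[OF y(1)]
    proof (intro ballI allI)
      fix v i and f :: "nat \<Rightarrow> 'f" assume v: "v \<in> V" and f: "f \<in> UNIV \<rightarrow> carrier F"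
      let ?f = "f(i := f i \<otimes>\<^bsub>F\<^esub> y)"
      let ?c = "word_value F ?f v \<otimes>\<^bsub>F\<^esub> inv\<^bsub>F\<^esub> (word_value F f v)"
      have f': "?f \<in> UNIV \<rightarrow> carrier F" using f y(1) by (simp add: Pi_iff)
      have cA: "\<alpha> ?c \<in> ?NA"
        using lift_word_value_mem[OF inf leA F(1) A presA liftA y(1) _ v f] y(2) a by simp
      have cB: "\<beta> ?c \<in> ?NB"
        using lift_word_value_mem[OF inf leB F(1) B presB liftB y(1) _ v f] y(2) b by simp
      have "word_value F ?f v \<in> verbal V F" "word_value F f v \<in> verbal V F"
        unfolding verbal_def using v f f' by (blast intro: generate.incl)+
      then have cV: "?c \<in> verbal V F"
        using subgroup.m_closed[OF verb] subgroup.m_inv_closed[OF verb] by blast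
      then have cc: "?c \<in> carrier F" by (rule subgroup.mem_carrier[OF verb])
      \<comment> \<open>The marginal commutator subgroups lie in the kernels of
        \<open>\<pi>\<^sub>A\<close> and \<open>\<pi>\<^sub>B\<close>, so both coordinates of
        \<open>\<pi> ?c\<close> vanish. Thus \<open>?c\<close>, verbal by construction, represents a
        class of the Baer invariant.\<close>
      have "fst (\<pi> ?c) = \<one>\<^bsub>A\<^esub>" "snd (\<pi> ?c) = \<one>\<^bsub>B\<^esub>"
        using subsetD[OF NA cA] subsetD[OF NB cB] \<alpha>(2)[OF cc] \<beta>(2)[OF cc]
        by (simp_all add: kernel_def)
      then have "?c \<in> ?R" using cc by (simp add: kernel_def prod_eq_iff)
      then show "?c \<in> N" using inj cV cA cB by blast
    qed
    then show "(a, b) \<in> epimarginal TYPE('e) V (A \<times>\<times> B)"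
      unfolding epimarginal_mem_iff
      using free_presentation_marginal_image[OF pres AB N_def y(1)] y(2) by metis
  qed
  then have eq: "epimarginal TYPE('e) V (A \<times>\<times> B) =
      epimarginal TYPE('e) V A \<times> epimarginal TYPE('e) V B"
    using epimarginal_DirProd_subset[OF inf le A B] by blast
  \<comment> \<open>Both factors contain one and are therefore non-empty, so the product determines
    each of them.\<close>
  moreover have "epimarginal TYPE('e) V A \<times> epimarginal TYPE('e) V B = {\<one>\<^bsub>A \<times>\<times> B\<^esub>} \<longleftrightarrow>
      epimarginal TYPE('e) V A = {\<one>\<^bsub>A\<^esub>} \<and> epimarginal TYPE('e) V B = {\<one>\<^bsub>B\<^esub>}"
    using one_in_epimarginal[OF A, of "TYPE('e)" V] one_in_epimarginal[OF B, of "TYPE('e)" V]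
    by auto
  ultimately show ?thesis
    unfolding capable_iff_epimarginal_trivial[OF inf le pres AB]
      capable_iff_epimarginal_trivial[OF inf leA presA A]
      capable_iff_epimarginal_trivial[OF inf leB presB B] by simp
qed

end
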